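(* Let $\Omega\subset\mathbb{R}^2$ be a bounded region whose boundary $\partial\Omega$ is the union of a finite number of disjoint simple Lipschitz loops, and let $\mathbf{v}\in G(\Omega)\cap\mathrm{Curl}(\Omega)$. Then the potentials $\varphi_v,\psi_v$ of $\mathbf{v}$ are conjugate harmonic functions on $\Omega$ and $\mathbf{v}$ is $C^\infty$ on $\Omega$.
   Context: A region is a non-empty connected open subset of $\mathbb{R}^2$. A simple Lipschitz loop is a closed, non-self-intersecting curve with at least two distinct points and a uniformly Lipschitz parametrization. $\nabla\varphi=(D_1\varphi,D_2\varphi)$, $\nabla^\perp\psi=(D_2\psi,-D_1\psi)$. $G(\Omega)=\{\nabla\varphi:\varphi\in H^1(\Omega)\}$ and $\mathrm{Curl}(\Omega)=\{\nabla^\perp\psi:\psi\in H^1(\Omega)\}$, both subspaces of $L^2(\Omega;\mathbb{R}^2)$. For $\mathbf{v}\in G(\Omega)\cap\mathrm{Curl}(\Omega)$, the potentials are functions $\varphi_v,\psi_v\in H^1(\Omega)$ (unique up to constants) with $\mathbf{v}=\nabla\varphi_v=\nabla^\perp\psi_v$ on $\Omega$. Two real harmonic functions $\varphi,\psi$ are conjugate if they satisfy the Cauchy–Riemann equations $D_1\varphi=D_2\psi$, $D_2\varphi=-D_1\psi$. *)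

theory Defs
  imports "HOL-Analysis.Analysis"
begin

definition partial_deriv :: "'n::finite \<Rightarrow> (real^'n \<Rightarrow> 'b::real_normed_vector) \<Rightarrow> real^'n \<Rightarrow> 'b"
  where "partial_deriv i f x = frechet_derivative f (at x) (axis i 1)"

(* Only used for open S, where the partial derivatives at points of S depend only on f on S. *)
primrec C_k_on :: "nat \<Rightarrow> (real^'n::finite \<Rightarrow> 'b::real_normed_vector) \<Rightarrow> (real^'n) set \<Rightarrow> bool"
  where
    "C_k_on 0 f S \<longleftrightarrow> continuous_on S f"
  | "C_k_on (Suc k) f S \<longleftrightarrow>
       (\<forall>x\<in>S. f differentiable (at x)) \<and> (\<forall>i. C_k_on k (partial_deriv i f) S)"

definition C_infinity_on :: "(real^'n::finite \<Rightarrow> 'b::real_normed_vector) \<Rightarrow> (real^'n) set \<Rightarrow> bool"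
  where "C_infinity_on f S \<longleftrightarrow> (\<forall>k. C_k_on k f S)"

definition harmonic_on :: "(real^2 \<Rightarrow> real) \<Rightarrow> (real^2) set \<Rightarrow> bool"
  where "harmonic_on f S \<longleftrightarrow>
    C_k_on 2 f S \<and>
    (\<forall>x\<in>S. partial_deriv 1 (partial_deriv 1 f) x + partial_deriv 2 (partial_deriv 2 f) x = 0)"

definition conjugate_harmonic_on :: "(real^2 \<Rightarrow> real) \<Rightarrow> (real^2 \<Rightarrow> real) \<Rightarrow> (real^2) set \<Rightarrow> bool"
  where "conjugate_harmonic_on \<phi> \<psi> S \<longleftrightarrow>
    harmonic_on \<phi> S \<and> harmonic_on \<psi> S \<and>
    (\<forall>x\<in>S. partial_deriv 1 \<phi> x = partial_deriv 2 \<psi> x \<and>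
            partial_deriv 2 \<phi> x = - partial_deriv 1 \<psi> x)"

definition region :: "(real^2) set \<Rightarrow> bool"
  where "region \<Omega> \<longleftrightarrow> \<Omega> \<noteq> {} \<and> connected \<Omega> \<and> open \<Omega>"

(* The requirement of two distinct points is implied: a simple path in the library sense is
   injective on the half-open interval from 0 to 1, so a constant path is not simple. *)
definition simple_lipschitz_loop :: "(real^2) set \<Rightarrow> bool"
  where "simple_lipschitz_loop C \<longleftrightarrow>
    (\<exists>g L. simple_path g \<and> pathfinish g = pathstart g \<and> lipschitz_on L {0..1} g \<and>
           C = path_image g)"

(* Elements of the function spaces below are functions rather than classes modulo equality almost
   everywhere; all these sets are closed under changing a function on a null subset of the domain,
   and values outside the domain are irrelevant. *)
definition L2_on :: "(real^2) set \<Rightarrow> (real^2 \<Rightarrow> 'b::euclidean_space) set"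
  where "L2_on \<Omega> = {f. f \<in> borel_measurable (lebesgue_on \<Omega>) \<and>
                       integrable (lebesgue_on \<Omega>) (\<lambda>x. (norm (f x))\<^sup>2)}"

definition test_functions :: "(real^2) set \<Rightarrow> (real^2 \<Rightarrow> real) set"
  where "test_functions \<Omega> = {\<eta>. C_infinity_on \<eta> UNIV \<and>
                               compact (closure {x. \<eta> x \<noteq> 0}) \<and> closure {x. \<eta> x \<noteq> 0} \<subseteq> \<Omega>}"

(* Square integrability of f and w makes both integrands integrable, so that the default
   value 0 of a non-existing Bochner integral never comes into play. *)
definition has_weak_gradient :: "(real^2) set \<Rightarrow> (real^2 \<Rightarrow> real) \<Rightarrow> (real^2 \<Rightarrow> real^2) \<Rightarrow> bool"
  where "has_weak_gradient \<Omega> f w \<longleftrightarrow>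
    f \<in> L2_on \<Omega> \<and> w \<in> L2_on \<Omega> \<and>
    (\<forall>\<eta>\<in>test_functions \<Omega>. \<forall>i.
       (\<integral>x. f x * partial_deriv i \<eta> x \<partial>(lebesgue_on \<Omega>)) =
       - (\<integral>x. w x $ i * \<eta> x \<partial>(lebesgue_on \<Omega>)))"

definition rotate_field :: "(real^2 \<Rightarrow> real^2) \<Rightarrow> (real^2 \<Rightarrow> real^2)"
  where "rotate_field w = (\<lambda>x. vector [w x $ 2, - (w x $ 1)])"

definition has_weak_perp_gradient :: "(real^2) set \<Rightarrow> (real^2 \<Rightarrow> real) \<Rightarrow> (real^2 \<Rightarrow> real^2) \<Rightarrow> bool"
  where "has_weak_perp_gradient \<Omega> f v \<longleftrightarrow> (\<exists>w. has_weak_gradient \<Omega> f w \<and> v = rotate_field w)"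

definition H1_on :: "(real^2) set \<Rightarrow> (real^2 \<Rightarrow> real) set"
  where "H1_on \<Omega> = {f. \<exists>w. has_weak_gradient \<Omega> f w}"

definition gradient_fields :: "(real^2) set \<Rightarrow> (real^2 \<Rightarrow> real^2) set"
  where "gradient_fields \<Omega> = {v. \<exists>\<phi>\<in>H1_on \<Omega>. has_weak_gradient \<Omega> \<phi> v}"

definition curl_fields :: "(real^2) set \<Rightarrow> (real^2 \<Rightarrow> real^2) set"
  where "curl_fields \<Omega> = {v. \<exists>\<psi>\<in>H1_on \<Omega>. has_weak_perp_gradient \<Omega> \<psi> v}"

definition potentials :: "(real^2) set \<Rightarrow> (real^2 \<Rightarrow> real^2) \<Rightarrow> (real^2 \<Rightarrow> real) \<Rightarrow> (real^2 \<Rightarrow> real) \<Rightarrow> bool"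
  where "potentials \<Omega> v \<phi> \<psi> \<longleftrightarrow>
    \<phi> \<in> H1_on \<Omega> \<and> \<psi> \<in> H1_on \<Omega> \<and> has_weak_gradient \<Omega> \<phi> v \<and> has_weak_perp_gradient \<Omega> \<psi> v"

end

theory Submission
  imports Defs "HOL-Complex_Analysis.Cauchy_Integral_Formula"
begin

text \<open>
If \<open>v = \<nabla>\<phi>\<close> and \<open>v\<close> is also the perpendicular gradient of \<open>\<psi>\<close>, then \<open>\<phi>\<close> and \<open>\<psi>\<close> satisfy the
Cauchy--Riemann equations weakly, so the claim is a form of Weyl's lemma: an integrable
function \<open>f = \<phi> + \<i> \<psi>\<close> with weakly vanishing \<open>\<partial>f / \<partial>cnj z\<close> is almost everywhere equal to a
holomorphic function \<open>G\<close>. Real and imaginary part of \<open>G\<close> are then the conjugate harmonic versions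
of the potentials.

The idea for Weyl's lemma is to test the weak equation with a smooth regularisation of the Cauchy
kernel \<open>1 / (z - w)\<close>, cut off near the boundary of a disc around a point \<open>p\<close>
(\<open>weakly_holomorphic_kernel_identity\<close>). The regularisation contributes the mean of \<open>f\<close> over a
small annulus around \<open>w\<close>, the cutoff contributes an integral of \<open>f (z) / (z - w)\<close> over an annulus
around \<open>p\<close>. So the mollification of \<open>f\<close> equals a Cauchy transform, which is holomorphic in \<open>w\<close>
near \<open>p\<close> (\<open>cauchy_transform_holomorphic\<close>) and does not involve the mollification radius at all.
Near \<open>p\<close> all mollifications with small radius are therefore the same holomorphic function.
Since mollifications of \<open>f\<close> converge to \<open>f\<close> (in the weak form
\<open>integral_box_eq_if_mollification_eq\<close>), the limit function equals \<open>f\<close> almost everywhere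
(\<open>weakly_holomorphic_imp_AE_eq_holomorphic\<close>).

Smoothness of \<open>v\<close> comes from a second application of the same lemma: being a gradient, \<open>v\<close> is weakly
curl-free, and being a perpendicular gradient, it is weakly divergence-free. These are the weak
Cauchy--Riemann equations for \<open>v\<^sub>1 - \<i> v\<^sub>2\<close>. The symmetry of second derivatives is needed here,
but only for test functions (\<open>mixed_partials_commute\<close>).
\<close>

section \<open>Functions of class C^k\<close>

lemma partial_deriv_eq:
  assumes "(f has_derivative f') (at x)"
  shows "partial_deriv i f x = f' (axis i 1)"
  using frechet_derivative_at[OF assms] by (simp add: partial_deriv_def)

lemma has_derivative_cong_open:
  assumes "open S" "x \<in> S" "\<And>y. y \<in> S \<Longrightarrow> f y = g y"
  shows "(f has_derivative f') (at x) \<longleftrightarrow> (g has_derivative f') (at x)"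
  using assms has_derivative_transform_within_open[of f f' x UNIV S g]
    has_derivative_transform_within_open[of g f' x UNIV S f] by auto

lemma partial_deriv_cong:
  assumes "open S" "x \<in> S" "\<And>y. y \<in> S \<Longrightarrow> f y = g y"
  shows "partial_deriv i f x = partial_deriv i g x"
  using has_derivative_cong_open[OF assms] by (simp add: partial_deriv_def frechet_derivative_def)

lemma C_k_on_cong:
  assumes "open S" "\<And>y. y \<in> S \<Longrightarrow> f y = g y"
  shows "C_k_on k f S \<longleftrightarrow> C_k_on k g S"
  using assms(2)
proof (induction k arbitrary: f g)
  case 0
  then show ?case by (simp cong: continuous_on_cong)
next
  case (Suc k)
  have "C_k_on k (partial_deriv i f) S = C_k_on k (partial_deriv i g) S" for i
    by (rule Suc.IH) (rule partial_deriv_cong[OF assms(1)], use Suc.prems in auto)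
  moreover have "f differentiable (at x) \<longleftrightarrow> g differentiable (at x)" if "x \<in> S" for x
    unfolding differentiable_def using has_derivative_cong_open[OF assms(1) that Suc.prems] by simp
  ultimately show ?case by simp
qed

lemma C_k_on_transform:
  assumes "open S" "C_k_on k g S" "\<And>y. y \<in> S \<Longrightarrow> f y = g y"
  shows "C_k_on k f S"
  using C_k_on_cong[OF assms(1), of f g] assms(2,3) by blast

lemma C_k_on_SucD: "C_k_on (Suc k) f S \<Longrightarrow> C_k_on k f S"
proof (induction k arbitrary: f)
  case 0
  then show ?case
    by (auto intro!: continuous_at_imp_continuous_on differentiable_imp_continuous_within)
next
  case (Suc k)
  have "C_k_on k (partial_deriv i f) S" for i
    using Suc.prems by (intro Suc.IH) simp
  then show ?case using Suc.prems by simp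
qed

lemma C_k_on_has_derivative:
  assumes "C_k_on (Suc k) f S" "x \<in> S"
  shows "(f has_derivative frechet_derivative f (at x)) (at x)"
  using assms frechet_derivative_works by auto

lemma C_k_on_add:
  assumes "open S" "C_k_on k f S" "C_k_on k g S"
  shows "C_k_on k (\<lambda>x. f x + g x) S"
  using assms(2,3)
proof (induction k arbitrary: f g)
  case 0
  then show ?case by (simp add: continuous_on_add)
next
  case (Suc k)
  have "C_k_on k (partial_deriv i (\<lambda>x. f x + g x)) S" for i
  proof -
    have "partial_deriv i (\<lambda>x. f x + g x) x = partial_deriv i f x + partial_deriv i g x"
      if "x \<in> S" for x
      using partial_deriv_eq[OF has_derivative_add[OF C_k_on_has_derivative[OF Suc.prems(1) that]
            C_k_on_has_derivative[OF Suc.prems(2) that]]]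
      by (simp add: partial_deriv_def)
    moreover have "C_k_on k (\<lambda>x. partial_deriv i f x + partial_deriv i g x) S"
      using Suc.prems by (intro Suc.IH) auto
    ultimately show ?thesis by (rule C_k_on_transform[OF assms(1), rotated])
  qed
  then show ?case using Suc.prems by (simp add: differentiable_add)
qed

lemma C_k_on_mult:
  fixes f g :: "real^'n::finite \<Rightarrow> real"
  assumes "open S" "C_k_on k f S" "C_k_on k g S"
  shows "C_k_on k (\<lambda>x. f x * g x) S"
  using assms(2,3)
proof (induction k arbitrary: f g)
  case 0
  then show ?case by (simp add: continuous_on_mult)
next
  case (Suc k)
  have "C_k_on k (partial_deriv i (\<lambda>x. f x * g x)) S" for i
  proof -
    have "partial_deriv i (\<lambda>x. f x * g x) x = f x * partial_deriv i g x + partial_deriv i f x * g x"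
      if "x \<in> S" for x
      using partial_deriv_eq[OF has_derivative_mult[OF C_k_on_has_derivative[OF Suc.prems(1) that]
            C_k_on_has_derivative[OF Suc.prems(2) that]]]
      by (simp add: partial_deriv_def)
    moreover have "C_k_on k (\<lambda>x. f x * partial_deriv i g x + partial_deriv i f x * g x) S"
      using Suc.prems by (intro C_k_on_add[OF assms(1)] Suc.IH) (auto intro: C_k_on_SucD)
    ultimately show ?thesis by (rule C_k_on_transform[OF assms(1), rotated])
  qed
  then show ?case using Suc.prems by (simp add: differentiable_mult)
qed

lemma C_k_on_const: "C_k_on k (\<lambda>x. c) S"
proof (induction k arbitrary: c)
  case (Suc k)
  have "partial_deriv i (\<lambda>x. c) = (\<lambda>x. 0)" for i :: 'a
    by (rule ext) (simp add: partial_deriv_eq[OF has_derivative_const])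
  then show ?case using Suc by simp
qed simp

lemma C_k_on_component: "C_k_on k (\<lambda>x::real^'n::finite. x $ j) S"
proof (cases k)
  case (Suc l)
  have "((\<lambda>x::real^'n. x $ j) has_derivative (\<lambda>x. x $ j)) (at x)" for x
    by (rule bounded_linear_imp_has_derivative) (rule bounded_linear_vec_nth)
  then have "partial_deriv i (\<lambda>x::real^'n. x $ j) = (\<lambda>x. axis i 1 $ j)"
    and "(\<lambda>x::real^'n. x $ j) differentiable (at x)" for i x
    using partial_deriv_eq by (fastforce simp: differentiable_def)+
  then show ?thesis using Suc by (simp add: C_k_on_const)
qed (simp add: continuous_on_component)

text \<open>The counterpart of \<open>C_k_on\<close> for functions of one real variable. Smooth functions on the plane are
obtained below by composing such functions with polynomials in the coordinates.\<close>
primrec real_C_k :: "nat \<Rightarrow> (real \<Rightarrow> real) \<Rightarrow> bool"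
  where
    "real_C_k 0 r \<longleftrightarrow> continuous_on UNIV r"
  | "real_C_k (Suc k) r \<longleftrightarrow> (\<exists>r'. (\<forall>x. (r has_real_derivative r' x) (at x)) \<and> real_C_k k r')"

lemma real_C_k_SucI:
  "(\<And>x. (r has_real_derivative r' x) (at x)) \<Longrightarrow> real_C_k k r' \<Longrightarrow> real_C_k (Suc k) r"
  by auto

lemma real_C_k_SucD: "real_C_k (Suc k) r \<Longrightarrow> real_C_k k r"
proof (induction k arbitrary: r)
  case 0
  then show ?case by (auto intro!: continuous_at_imp_continuous_on intro: DERIV_isCont)
next
  case (Suc k)
  then show ?case by (metis real_C_k.simps(2))
qed

lemma real_C_k_const: "real_C_k k (\<lambda>x. c)"
  by (induction k arbitrary: c) (auto intro!: exI[of _ "\<lambda>x. 0"])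

lemma real_C_k_add: "real_C_k k r \<Longrightarrow> real_C_k k s \<Longrightarrow> real_C_k k (\<lambda>x. r x + s x)"
proof (induction k arbitrary: r s)
  case (Suc k)
  then obtain r' s' where "\<And>x. (r has_real_derivative r' x) (at x)" "real_C_k k r'"
    "\<And>x. (s has_real_derivative s' x) (at x)" "real_C_k k s'" by auto
  with Suc.IH show ?case by (auto intro!: exI[of _ "\<lambda>x. r' x + s' x"] DERIV_add)
qed (simp add: continuous_on_add)

lemma real_C_k_mult: "real_C_k k r \<Longrightarrow> real_C_k k s \<Longrightarrow> real_C_k k (\<lambda>x. r x * s x)"
proof (induction k arbitrary: r s)
  case (Suc k)
  then obtain r' s' where d: "\<And>x. (r has_real_derivative r' x) (at x)" "real_C_k k r'"
    "\<And>x. (s has_real_derivative s' x) (at x)" "real_C_k k s'" by auto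
  have "((\<lambda>x. r x * s x) has_real_derivative r' x * s x + r x * s' x) (at x)" for x
    using DERIV_mult[OF d(1,3)] by (simp add: algebra_simps)
  moreover have "real_C_k k (\<lambda>x. r' x * s x + r x * s' x)"
    using d Suc by (intro real_C_k_add Suc.IH real_C_k_SucD[of k r] real_C_k_SucD[of k s])
  ultimately show ?case by (rule real_C_k_SucI)
qed (simp add: continuous_on_mult)

lemma real_C_k_affine: "real_C_k k r \<Longrightarrow> real_C_k k (\<lambda>x. r (a * x + b))"
proof (induction k arbitrary: r)
  case 0
  then show ?case by (auto intro!: continuous_on_compose2[of UNIV r] continuous_intros)
next
  case (Suc k)
  then obtain r' where d: "\<And>x. (r has_real_derivative r' x) (at x)" "real_C_k k r'" by auto
  have "((\<lambda>x. r (a * x + b)) has_real_derivative r' (a * x + b) * a) (at x)" for x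
    by (rule DERIV_chain2[OF d(1)]) (auto intro!: derivative_eq_intros)
  moreover have "real_C_k k (\<lambda>x. r' (a * x + b) * a)"
    by (intro real_C_k_mult real_C_k_const Suc.IH d)
  ultimately show ?case by (rule real_C_k_SucI)
qed

lemma C_k_on_compose:
  assumes "open S" "real_C_k k r" "C_k_on k q S"
  shows "C_k_on k (\<lambda>x. r (q x)) S"
  using assms(2,3)
proof (induction k arbitrary: r)
  case 0
  then show ?case by (auto intro!: continuous_on_compose2[of UNIV r])
next
  case (Suc k)
  then obtain r' where d: "\<And>x. (r has_real_derivative r' x) (at x)" "real_C_k k r'" by auto
  have D: "((\<lambda>x. r (q x)) has_derivative (\<lambda>y. r' (q x) * frechet_derivative q (at x) y)) (at x)"
    if "x \<in> S" for x
    using has_derivative_compose[OF C_k_on_has_derivative[OF Suc.prems(2) that]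
        d(1)[of "q x", unfolded has_field_derivative_def]] by simp
  have "C_k_on k (partial_deriv i (\<lambda>x. r (q x))) S" for i
  proof -
    have "partial_deriv i (\<lambda>x. r (q x)) x = r' (q x) * partial_deriv i q x" if "x \<in> S" for x
      using partial_deriv_eq[OF D[OF that]] by (simp add: partial_deriv_def)
    moreover have "C_k_on k (\<lambda>x. r' (q x) * partial_deriv i q x) S"
    proof (rule C_k_on_mult[OF assms(1)])
      show "C_k_on k (\<lambda>x. r' (q x)) S"
        by (rule Suc.IH[OF d(2) C_k_on_SucD[OF Suc.prems(2)]])
      show "C_k_on k (partial_deriv i q) S"
        using Suc.prems(2) by simp
    qed
    ultimately show ?thesis by (rule C_k_on_transform[OF assms(1), rotated])
  qed
  then show ?case using D by (auto simp: differentiable_def)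
qed

section \<open>Symmetry of second derivatives\<close>

lemma has_real_derivative_along_axis:
  fixes f :: "real^'n::finite \<Rightarrow> real"
  assumes "f differentiable (at (x + t *\<^sub>R axis i 1))"
  shows "((\<lambda>t. f (x + t *\<^sub>R axis i 1)) has_real_derivative partial_deriv i f (x + t *\<^sub>R axis i 1)) (at t)"
proof -
  let ?y = "x + t *\<^sub>R axis i 1"
  have "(f has_derivative frechet_derivative f (at ?y)) (at ?y)"
    using assms by (simp add: frechet_derivative_works)
  moreover have "((\<lambda>t. x + t *\<^sub>R axis i 1) has_derivative (\<lambda>t. t *\<^sub>R axis i 1)) (at t)"
    by (auto intro!: derivative_eq_intros)
  ultimately have "((\<lambda>t. f (x + t *\<^sub>R axis i 1)) has_derivative
      (\<lambda>t. frechet_derivative f (at ?y) (t *\<^sub>R axis i 1))) (at t)"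
    by (rule has_derivative_compose[rotated])
  moreover have "frechet_derivative f (at ?y) (s *\<^sub>R axis i 1) = partial_deriv i f ?y * s" for s
    using linear_frechet_derivative[OF assms] by (simp add: partial_deriv_def linear_scale)
  ultimately show ?thesis by (simp add: has_field_derivative_def)
qed

text \<open>Two applications of the mean value theorem: first to the difference of \<open>f\<close> over a step in
direction \<open>j\<close>, as a function of the coordinate \<open>i\<close>, then to the partial derivative that
results. The left-hand side is symmetric in \<open>i\<close> and \<open>j\<close>.\<close>
lemma second_difference_eq_mixed_partial:
  fixes f :: "real^'n::finite \<Rightarrow> real"
  assumes "C_k_on 2 f UNIV" and "s > 0"
  obtains a b where "0 < a" "a < s" "0 < b" "b < s"
    "f (x + s *\<^sub>R axis i 1 + s *\<^sub>R axis j 1) - f (x + s *\<^sub>R axis i 1) - f (x + s *\<^sub>R axis j 1) + f x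
      = s * s * partial_deriv j (partial_deriv i f) (x + a *\<^sub>R axis i 1 + b *\<^sub>R axis j 1)"
proof -
  have diff: "f differentiable (at y)" "partial_deriv i f differentiable (at y)" for y
    using assms(1) by (simp_all add: numeral_2_eq_2)
  define g where "g t = f ((x + s *\<^sub>R axis j 1) + t *\<^sub>R axis i 1) - f (x + t *\<^sub>R axis i 1)" for t
  have "\<exists>a. 0 < a \<and> a < s \<and> g s - g 0 = (s - 0) *
    (partial_deriv i f ((x + s *\<^sub>R axis j 1) + a *\<^sub>R axis i 1) - partial_deriv i f (x + a *\<^sub>R axis i 1))"
    unfolding g_def by (rule MVT2) (use assms(2) diff in \<open>auto intro!: DERIV_diff has_real_derivative_along_axis\<close>)
  then obtain a where a: "0 < a" "a < s" "g s - g 0 = s *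
    (partial_deriv i f ((x + s *\<^sub>R axis j 1) + a *\<^sub>R axis i 1) - partial_deriv i f (x + a *\<^sub>R axis i 1))"
    by auto
  let ?y = "x + a *\<^sub>R axis i 1"
  have "\<exists>b. 0 < b \<and> b < s \<and> partial_deriv i f (?y + s *\<^sub>R axis j 1) - partial_deriv i f (?y + 0 *\<^sub>R axis j 1)
     = (s - 0) * partial_deriv j (partial_deriv i f) (?y + b *\<^sub>R axis j 1)"
    by (rule MVT2) (use assms(2) diff in \<open>auto intro!: has_real_derivative_along_axis\<close>)
  then obtain b where "0 < b" "b < s" "partial_deriv i f (?y + s *\<^sub>R axis j 1) - partial_deriv i f ?y
     = s * partial_deriv j (partial_deriv i f) (?y + b *\<^sub>R axis j 1)"
    by auto
  with a show ?thesis
    by (intro that[of a b]) (auto simp: g_def algebra_simps)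
qed

text \<open>Both mixed derivatives at points near \<open>x\<close> are the same second difference quotient; as the step
tends to 0, continuity moves both points to \<open>x\<close>.\<close>
lemma mixed_partials_commute:
  fixes f :: "real^'n::finite \<Rightarrow> real"
  assumes "C_k_on 2 f UNIV"
  shows "partial_deriv i (partial_deriv j f) x = partial_deriv j (partial_deriv i f) x"
proof -
  define P where "P = partial_deriv j (partial_deriv i f)"
  define Q where "Q = partial_deriv i (partial_deriv j f)"
  have cont: "isCont P x" "isCont Q x"
    using assms by (auto simp: numeral_2_eq_2 P_def Q_def continuous_on_eq_continuous_at)
  have near: "dist (x + a *\<^sub>R axis k 1 + b *\<^sub>R axis l 1) x < 2 * s"
    if "0 < a" "a < s" "0 < b" "b < s" for a b s and k l :: 'n
  proof -
    have "norm (a *\<^sub>R axis k 1 + b *\<^sub>R axis l (1::real)) \<le> a + b"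
      using norm_triangle_ineq[of "a *\<^sub>R axis k 1" "b *\<^sub>R axis l (1::real)"] that by simp
    then show ?thesis using that by (simp add: dist_norm add.assoc)
  qed
  have "\<exists>u v. dist u x < 2 * s \<and> dist v x < 2 * s \<and> P u = Q v" if s: "s > 0" for s
  proof -
    obtain a b where 1: "0 < a" "a < s" "0 < b" "b < s"
      "f (x + s *\<^sub>R axis i 1 + s *\<^sub>R axis j 1) - f (x + s *\<^sub>R axis i 1) - f (x + s *\<^sub>R axis j 1) + f x
      = s * s * P (x + a *\<^sub>R axis i 1 + b *\<^sub>R axis j 1)"
      using second_difference_eq_mixed_partial[OF assms s] unfolding P_def by blast
    obtain c d where 2: "0 < c" "c < s" "0 < d" "d < s"
      "f (x + s *\<^sub>R axis j 1 + s *\<^sub>R axis i 1) - f (x + s *\<^sub>R axis j 1) - f (x + s *\<^sub>R axis i 1) + f x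
      = s * s * Q (x + c *\<^sub>R axis j 1 + d *\<^sub>R axis i 1)"
      using second_difference_eq_mixed_partial[OF assms s] unfolding Q_def by blast
    have "s * s * P (x + a *\<^sub>R axis i 1 + b *\<^sub>R axis j 1) = s * s * Q (x + c *\<^sub>R axis j 1 + d *\<^sub>R axis i 1)"
      using 1(5) 2(5) by (simp add: algebra_simps)
    then have "P (x + a *\<^sub>R axis i 1 + b *\<^sub>R axis j 1) = Q (x + c *\<^sub>R axis j 1 + d *\<^sub>R axis i 1)"
      using s by simp
    then show ?thesis using near[OF 1(1-4), of i j] near[OF 2(1-4), of j i] by blast
  qed
  then have "\<exists>u v. dist u x < 2 / real (Suc n) \<and> dist v x < 2 / real (Suc n) \<and> P u = Q v" for n
    by (metis divide_pos_pos mult.right_neutral of_nat_0_less_iff times_divide_eq_right zero_less_Suc zero_less_one)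
  then obtain u v where uv: "\<And>n. dist (u n) x < 2 / real (Suc n)" "\<And>n. dist (v n) x < 2 / real (Suc n)"
    and eq: "\<And>n. P (u n) = Q (v n)"
    by metis
  have lim: "w \<longlonglongrightarrow> x" if "\<And>n. dist (w n) x < 2 / real (Suc n)" for w
  proof (rule metric_tendsto_imp_tendsto)
    show "(\<lambda>n. 2 / real (Suc n)) \<longlonglongrightarrow> 0"
      using LIMSEQ_Suc[OF lim_const_over_n[of "2::real"]] by simp
    show "\<forall>\<^sub>F n in sequentially. dist (w n) x \<le> dist (2 / real (Suc n)) 0"
      using that by (intro always_eventually) (auto simp: less_imp_le)
  qed
  have "(\<lambda>n. P (u n)) \<longlonglongrightarrow> P x"
    by (rule isCont_tendsto_compose[OF cont(1) lim[OF uv(1)]])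
  moreover have "(\<lambda>n. P (u n)) \<longlonglongrightarrow> Q x"
    unfolding eq by (rule isCont_tendsto_compose[OF cont(2) lim[OF uv(2)]])
  ultimately show ?thesis unfolding P_def Q_def by (metis LIMSEQ_unique)
qed

section \<open>A smooth transition function\<close>

lemma exp_neg_inverse_over_power_tendsto_0:
  "((\<lambda>t::real. exp (- 1 / t) / t ^ n) \<longlongrightarrow> 0) (at_right 0)"
proof -
  have "((\<lambda>y::real. y ^ n / exp y) \<longlongrightarrow> 0) at_top"
    by (rule tendsto_power_div_exp_0)
  then have "((\<lambda>t. inverse t ^ n / exp (inverse t)) \<longlongrightarrow> (0::real)) (at_right 0)"
    by (rule filterlim_compose) (rule filterlim_inverse_at_top_right)
  moreover have "inverse t ^ n / exp (inverse t) = exp (- 1 / t) / t ^ n" for t :: real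
    by (simp add: exp_minus field_simps)
  ultimately show ?thesis by simp
qed

text \<open>Taking all \<open>n\<close> at once makes the family closed under differentiation up to linear combinations,
so that induction on the order of differentiability works. The value at 0 is harmless because
every member of the family vanishes there faster than any power.\<close>
lemma real_C_k_exp_neg_inverse:
  "real_C_k k (\<lambda>t. if t > 0 then exp (- 1 / t) / t ^ n else 0)"
proof (induction k arbitrary: n)
  case (Suc k)
  define E where "E n t = (if t > 0 then exp (- 1 / t) / t ^ n else 0)" for n and t :: real
  have "(E n has_real_derivative E (n + 2) x + - real n * E (n + 1) x) (at x)" for x
  proof -
    consider "x > 0" | "x < 0" | "x = 0" by linarith
    then show ?thesis
    proof cases
      case 1
      have "((\<lambda>t. exp (- 1 / t) / t ^ n) has_real_derivative E (n + 2) x + - real n * E (n + 1) x) (at x)"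
        using 1 by (auto intro!: derivative_eq_intros simp: E_def divide_simps power2_eq_square)
          (cases n; simp add: algebra_simps)
      then show ?thesis
        using 1 by (rule_tac has_field_derivative_transform_within_open[where S = "{0<..}"])
          (auto simp: E_def)
    next
      case 2
      have "((\<lambda>t. 0) has_real_derivative E (n + 2) x + - real n * E (n + 1) x) (at x)"
        using 2 by (simp add: E_def)
      then show ?thesis
        using 2 by (rule_tac has_field_derivative_transform_within_open[where S = "{..<0}"])
          (auto simp: E_def)
    next
      case 3
      have "((\<lambda>t. E n t / t) \<longlongrightarrow> 0) (at_right 0)"
      proof (rule Lim_transform_eventually[OF exp_neg_inverse_over_power_tendsto_0[of "Suc n"]])
        show "\<forall>\<^sub>F t in at_right 0. exp (- 1 / t) / t ^ Suc n = E n t / t"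
          by (auto simp: eventually_at_right_field E_def intro!: exI[of _ 1])
      qed
      moreover have "((\<lambda>t. E n t / t) \<longlongrightarrow> 0) (at_left 0)"
      proof (rule Lim_transform_eventually[OF tendsto_const])
        show "\<forall>\<^sub>F t in at_left 0. 0 = E n t / t"
          by (auto simp: eventually_at_left_field E_def intro!: exI[of _ "-1"])
      qed
      ultimately have "((\<lambda>t. E n t / t) \<longlongrightarrow> 0) (at 0)"
        by (simp add: filterlim_split_at)
      then show ?thesis
        using 3 by (simp add: has_field_derivative_iff E_def)
    qed
  qed
  moreover have "real_C_k k (\<lambda>x. E (n + 2) x + - real n * E (n + 1) x)"
    unfolding E_def by (intro real_C_k_add real_C_k_mult real_C_k_const Suc.IH)
  ultimately have "real_C_k (Suc k) (E n)" by (rule real_C_k_SucI)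
  then show ?case by (simp add: E_def[abs_def])
next
  case 0
  define E where "E t = (if t > 0 then exp (- 1 / t) / t ^ n else 0)" for t :: real
  have "isCont E x" for x
  proof -
    consider "x > 0" | "x < 0" | "x = 0" by linarith
    then show ?thesis
    proof cases
      case 1
      have "\<forall>\<^sub>F t in nhds x. E t = exp (- 1 / t) / t ^ n"
        using 1 eventually_nhds_in_open[of "{0<..}" x] by (auto simp: E_def elim!: eventually_mono)
      then show ?thesis
        using 1 by (subst isCont_cong[where g = "\<lambda>t. exp (- 1 / t) / t ^ n"])
          (auto intro!: continuous_intros)
    next
      case 2
      have "\<forall>\<^sub>F t in nhds x. E t = 0"
        using 2 eventually_nhds_in_open[of "{..<0}" x] by (auto simp: E_def elim!: eventually_mono)
      then show ?thesis
        using 2 by (subst isCont_cong[where g = "\<lambda>t. 0"]) auto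
    next
      case 3
      have "(E \<longlongrightarrow> 0) (at_right 0)"
        by (rule Lim_transform_eventually[OF exp_neg_inverse_over_power_tendsto_0[of n]])
          (auto simp: eventually_at_right_field E_def intro!: exI[of _ 1])
      moreover have "(E \<longlongrightarrow> 0) (at_left 0)"
        by (rule Lim_transform_eventually[OF tendsto_const])
          (auto simp: eventually_at_left_field E_def intro!: exI[of _ "-1"])
      ultimately show ?thesis
        using 3 by (simp add: isCont_def filterlim_split_at E_def)
    qed
  qed
  then show ?case by (simp add: E_def[abs_def] continuous_at_imp_continuous_on)
qed

text \<open>The singularity of \<open>1 / s\<close> lies where \<open>r\<close> vanishes. The derivative of \<open>r s / s\<close> is
\<open>r' s / s - (r s / s) / s\<close>, to which the induction hypothesis applies, twice for the last term.\<close>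
lemma real_C_k_divide_by_argument:
  assumes "d > 0" "real_C_k k r" "\<And>s. s < d \<Longrightarrow> r s = 0"
  shows "real_C_k k (\<lambda>s. r s / s)"
  using assms(2,3)
proof (induction k arbitrary: r)
  case 0
  have "isCont (\<lambda>s. r s / s) x" for x
  proof (cases "x < d")
    case True
    have "\<forall>\<^sub>F t in nhds x. r t / t = 0"
      using True 0 eventually_nhds_in_open[of "{..<d}" x] by (auto elim!: eventually_mono)
    then show ?thesis by (subst isCont_cong[where g = "\<lambda>t. 0"]) auto
  next
    case False
    then show ?thesis using assms(1) 0
      by (intro continuous_divide) (auto simp: continuous_on_eq_continuous_at)
  qed
  then show ?case by (simp add: continuous_at_imp_continuous_on)
next
  case (Suc k)
  then obtain r' where d: "\<And>x. (r has_real_derivative r' x) (at x)" "real_C_k k r'" by auto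
  have r'0: "r' s = 0" if "s < d" for s
  proof (rule DERIV_unique[OF d(1)])
    show "(r has_real_derivative 0) (at s)"
      by (rule has_field_derivative_transform_within_open[where S = "{..<d}" and f = "\<lambda>_. 0"])
        (use that Suc.prems in auto)
  qed
  have "((\<lambda>s. r s / s) has_real_derivative r' x / x + - 1 * (r x / x / x)) (at x)" for x
  proof (cases "x < d")
    case True
    show ?thesis
      by (rule has_field_derivative_transform_within_open[where S = "{..<d}" and f = "\<lambda>_. 0"])
        (use True Suc.prems r'0 in auto)
  next
    case False
    then show ?thesis using assms(1) d(1)[of x]
      by (auto intro!: derivative_eq_intros simp: field_simps)
  qed
  moreover have "real_C_k k (\<lambda>x. r' x / x + - 1 * (r x / x / x))"
    by (intro real_C_k_add real_C_k_mult real_C_k_const; intro Suc.IH)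
      (use Suc.prems d r'0 real_C_k_SucD in auto)
  ultimately show ?case by (rule real_C_k_SucI)
qed

text \<open>A smooth transition from 0 to 1 together with its derivative. The numbers 1/4 and 1 are squares
of 1/2 and 1 because \<open>H\<close> will be applied to squared distances.\<close>
locale smooth_cutoff =
  fixes H h :: "real \<Rightarrow> real"
  assumes smooth: "real_C_k k H"
    and deriv: "(H has_real_derivative h s) (at s)"
    and cont: "continuous_on UNIV h"
    and H_0: "s \<le> 1/4 \<Longrightarrow> H s = 0"
    and H_1: "s \<ge> 1 \<Longrightarrow> H s = 1"
    and h_0: "s \<le> 1/4 \<or> s \<ge> 1 \<Longrightarrow> h s = 0"
    and h_pos: "1/4 < s \<Longrightarrow> s < 1 \<Longrightarrow> h s > 0"

lemma ex_smooth_cutoff: "\<exists>H h. smooth_cutoff H h"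
proof -
  define E where "E t = (if t > 0 then exp (- 1 / t) / t ^ 0 else 0)" for t :: real
  \<comment> \<open>a bump that is positive exactly between 1/4 and 1; its normalised primitive is the transition\<close>
  define b where "b s = E (1 * s + - 1/4) * E (- 1 * s + 1)" for s
  have E: "real_C_k k E" for k
    unfolding E_def[abs_def] by (rule real_C_k_exp_neg_inverse)
  have b: "real_C_k k b" for k
    unfolding b_def[abs_def]
    by (intro real_C_k_mult real_C_k_affine) (simp_all only: E)
  have b0: "b s = 0" if "s \<le> 1/4 \<or> s \<ge> 1" for s using that by (auto simp: b_def E_def)
  have bp: "b s > 0" if "1/4 < s" "s < 1" for s using that by (auto simp: b_def E_def)
  have bc: "continuous_on UNIV b" using b[of 0] by simp
  obtain F where F: "(F has_real_derivative b s) (at s)" for s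
  proof -
    have "\<exists>F. \<forall>x::real. -\<infinity> < ereal x \<longrightarrow> ereal x < \<infinity> \<longrightarrow> (F has_vector_derivative b x) (at x)"
      by (rule einterval_antiderivative) (use bc in \<open>auto simp: continuous_on_eq_continuous_at\<close>)
    then show ?thesis using that by (auto simp: has_real_derivative_iff_has_vector_derivative)
  qed
  have Fc: "continuous_on A F" for A
    using F by (auto intro!: continuous_at_imp_continuous_on intro: DERIV_isCont)
  have const: "F y = F x" if "x \<le> y" "\<And>s. x < s \<Longrightarrow> s < y \<Longrightarrow> b s = 0" for x y
  proof (cases "x = y")
    case False
    show ?thesis
      by (rule DERIV_isconst_end) (use that False Fc in \<open>auto simp flip: that(2) intro: F\<close>)
  qed simp
  have left: "F s = F (1/4)" if "s \<le> 1/4" for s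
    using const[of s "1/4"] that b0 by simp
  have right: "F s = F 1" if "s \<ge> 1" for s
    using const[of 1 s] that b0 by simp
  have pos: "F (1/4) < F 1"
    by (rule DERIV_pos_imp_increasing_open[where f = F]) (use F bp Fc in \<open>simp, blast, blast\<close>)
  define c where "c = 1 / (F 1 - F (1/4))"
  have "c > 0" using pos by (simp add: c_def)
  have "smooth_cutoff (\<lambda>s. c * (F s + - F (1/4))) (\<lambda>s. c * b s)"
  proof
    fix k
    have "real_C_k k F" using real_C_k_SucI[OF F b] by (rule real_C_k_SucD)
    then show "real_C_k k (\<lambda>s. c * (F s + - F (1/4)))"
      by (intro real_C_k_add real_C_k_mult real_C_k_const)
  next
    show "((\<lambda>s. c * (F s + - F (1/4))) has_real_derivative c * b s) (at s)" for s
      using F[of s] by (auto intro!: derivative_eq_intros)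
  next
    show "c * (F s + - F (1/4)) = 1" if "s \<ge> 1" for s
      using right[OF that] pos by (simp add: c_def)
    show "continuous_on UNIV (\<lambda>s. c * b s)" by (intro continuous_intros bc)
    show "c * (F s + - F (1/4)) = 0" if "s \<le> 1/4" for s
      using left[OF that] by simp
    show "c * b s = 0" if "s \<le> 1/4 \<or> s \<ge> 1" for s
      using b0[OF that] by simp
    show "c * b s > 0" if "1/4 < s" "s < 1" for s
      using bp[OF that] \<open>c > 0\<close> by simp
  qed
  then show ?thesis by blast
qed

section \<open>Weakly holomorphic functions and the regularised Cauchy kernel\<close>

lemma test_function_partial_deriv:
  assumes "\<eta> \<in> test_functions \<Omega>"
  shows "partial_deriv i \<eta> \<in> test_functions \<Omega>"
proof -
  have "partial_deriv i \<eta> x = 0" if "x \<notin> closure {x. \<eta> x \<noteq> 0}" for x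
  proof -
    have "partial_deriv i \<eta> x = partial_deriv i (\<lambda>_. 0) x"
      by (rule partial_deriv_cong[of "- closure {x. \<eta> x \<noteq> 0}"])
        (use that closure_subset[of "{x. \<eta> x \<noteq> 0}"] in auto)
    then show ?thesis by (simp add: partial_deriv_eq[OF has_derivative_const])
  qed
  then have "closure {x. partial_deriv i \<eta> x \<noteq> 0} \<subseteq> closure {x. \<eta> x \<noteq> 0}"
    by (intro closure_minimal) auto
  moreover have "C_infinity_on (partial_deriv i \<eta>) UNIV"
    using assms unfolding test_functions_def C_infinity_on_def by (metis (no_types, lifting) C_k_on.simps(2) mem_Collect_eq)
  ultimately show ?thesis
    using assms by (auto simp: test_functions_def compact_eq_bounded_closed intro: bounded_subset)
qed

lemma test_function_continuous: "\<eta> \<in> test_functions \<Omega> \<Longrightarrow> continuous_on UNIV \<eta>"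
  unfolding test_functions_def C_infinity_on_def by (metis (no_types, lifting) C_k_on.simps(1) mem_Collect_eq)

lemma test_function_measurable [measurable]:
  assumes "\<eta> \<in> test_functions \<Omega>"
  shows "\<eta> \<in> borel_measurable borel"
  using test_function_continuous[OF assms] by (rule borel_measurable_continuous_onI)

lemma test_function_bounded:
  assumes "\<eta> \<in> test_functions \<Omega>"
  obtains B where "\<And>x. \<bar>\<eta> x\<bar> \<le> B"
proof -
  have "compact (\<eta> ` closure {x. \<eta> x \<noteq> 0})"
    using assms test_function_continuous[OF assms]
    by (auto simp: test_functions_def intro!: compact_continuous_image intro: continuous_on_subset)
  then obtain B where B: "\<And>x. x \<in> closure {x. \<eta> x \<noteq> 0} \<Longrightarrow> \<bar>\<eta> x\<bar> \<le> B"
    using compact_imp_bounded bounded_iff by (metis image_eqI real_norm_def)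
  have "\<bar>\<eta> x\<bar> \<le> max B 0" for x
    using B[of x] closure_subset[of "{x. \<eta> x \<noteq> 0}"] by (cases "\<eta> x = 0") auto
  then show ?thesis by (rule that)
qed

lemma integrable_mult_bounded:
  fixes f g :: "'a \<Rightarrow> 'b::{real_normed_algebra,banach,second_countable_topology}"
  assumes "integrable M f" "g \<in> borel_measurable M" "\<And>x. norm (g x) \<le> B"
  shows "integrable M (\<lambda>x. f x * g x)"
proof (rule Bochner_Integration.integrable_bound)
  show "integrable M (\<lambda>x. B * norm (f x))" using assms(1) by simp
  show "(\<lambda>x. f x * g x) \<in> borel_measurable M" using assms(1,2) by measurable
  have "norm (f x * g x) \<le> norm (B * norm (f x))" for x
  proof -
    have "norm (f x * g x) \<le> norm (f x) * norm (g x)" by (rule norm_mult_ineq)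
    also have "\<dots> \<le> norm (f x) * B" by (intro mult_left_mono assms(3)) simp
    also have "\<dots> \<le> norm (B * norm (f x))" by (simp add: mult.commute)
    finally show ?thesis .
  qed
  then show "AE x in M. norm (f x * g x) \<le> norm (B * norm (f x))" by simp
qed

definition complex_of_vec :: "real^2 \<Rightarrow> complex"
  where "complex_of_vec z = Complex (z $ 1) (z $ 2)"

lemma complex_of_vec_simps [simp]:
  "Re (complex_of_vec z) = z $ 1" "Im (complex_of_vec z) = z $ 2"
  by (simp_all add: complex_of_vec_def)

lemma bounded_linear_complex_of_vec: "bounded_linear complex_of_vec"
  unfolding linear_conv_bounded_linear[symmetric]
proof -
  show "linear complex_of_vec" by (rule linearI) (auto simp: complex_eq_iff)
qed

lemma complex_of_vec_diff: "complex_of_vec (x - y) = complex_of_vec x - complex_of_vec y"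
  by (simp add: complex_eq_iff)

lemma norm_complex_of_vec [simp]: "norm (complex_of_vec z) = norm z"
  by (simp add: cmod_def norm_vec_def L2_set_def sum_2)

lemma dist_complex_of_vec: "dist (complex_of_vec x) (complex_of_vec y) = dist x y"
  by (simp add: dist_norm flip: complex_of_vec_diff)

lemma continuous_on_complex_of_vec [continuous_intros]:
  "continuous_on S f \<Longrightarrow> continuous_on S (\<lambda>x. complex_of_vec (f x))"
  by (rule bounded_linear.continuous_on[OF bounded_linear_complex_of_vec])

lemma measurable_complex_of_vec [measurable]: "complex_of_vec \<in> borel_measurable borel"
  by (intro borel_measurable_continuous_onI continuous_intros)

text \<open>The factor is twice the derivative of \<open>\<eta>\<close> with respect to the complex conjugate of \<open>z\<close>. For
\<open>f = \<phi> + \<i> \<psi>\<close> the real and imaginary parts of the condition are the weak Cauchy--Riemann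
equations.\<close>
definition weakly_holomorphic :: "(real^2) set \<Rightarrow> (real^2 \<Rightarrow> complex) \<Rightarrow> bool"
  where "weakly_holomorphic \<Omega> f \<longleftrightarrow>
    (\<forall>\<eta>\<in>test_functions \<Omega>.
       (\<integral>z. f z * Complex (partial_deriv 1 \<eta> z) (partial_deriv 2 \<eta> z) \<partial>lborel) = 0)"

lemma integrable_mult_gradient:
  assumes "integrable lborel f" "\<eta> \<in> test_functions \<Omega>"
  shows "integrable lborel (\<lambda>z. f z * Complex (partial_deriv 1 \<eta> z) (partial_deriv 2 \<eta> z))"
proof -
  note t = test_function_partial_deriv[OF assms(2)]
  obtain B1 where B1: "\<And>x. \<bar>partial_deriv 1 \<eta> x\<bar> \<le> B1" using test_function_bounded[OF t] by blast
  obtain B2 where B2: "\<And>x. \<bar>partial_deriv 2 \<eta> x\<bar> \<le> B2" using test_function_bounded[OF t] by blast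
  note [measurable] = test_function_measurable[OF t]
  show ?thesis
  proof (rule integrable_mult_bounded[OF assms(1)])
    show "(\<lambda>z. Complex (partial_deriv 1 \<eta> z) (partial_deriv 2 \<eta> z)) \<in> borel_measurable lborel"
      unfolding Complex_eq by measurable
    show "norm (Complex (partial_deriv 1 \<eta> z) (partial_deriv 2 \<eta> z)) \<le> B1 + B2" for z
      using cmod_le[of "Complex (partial_deriv 1 \<eta> z) (partial_deriv 2 \<eta> z)"] B1[of z] B2[of z] by simp
  qed
qed

context smooth_cutoff
begin

lemma h_nonneg: "h s \<ge> 0"
  using h_0[of s] h_pos[of s] by (cases "s \<le> 1/4 \<or> s \<ge> 1") auto

lemma h_bounded: obtains B where "\<And>s. \<bar>h s\<bar> \<le> B"
proof -
  have "compact (h ` {1/4..1})"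
    by (rule compact_continuous_image) (auto intro: continuous_on_subset[OF cont])
  then obtain B where B: "\<And>s. s \<in> {1/4..1} \<Longrightarrow> \<bar>h s\<bar> \<le> B"
    using compact_imp_bounded bounded_iff by (metis image_eqI real_norm_def)
  have "\<bar>h s\<bar> \<le> max B 0" for s
    using B[of s] h_0[of s] by (cases "s \<in> {1/4..1}") auto
  then show ?thesis by (rule that)
qed

lemma h_measurable [measurable]: "h \<in> borel_measurable borel"
  using cont by (rule borel_measurable_continuous_onI)

text \<open>A radial weight that lives on the annulus between the radii \<open>\<epsilon> / 2\<close> and \<open>\<epsilon>\<close>.\<close>
definition mollifier :: "real \<Rightarrow> real^2 \<Rightarrow> real"
  where "mollifier \<epsilon> x = h ((norm x)\<^sup>2 / \<epsilon>\<^sup>2) / \<epsilon>\<^sup>2"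

lemma mollifier_support:
  assumes "0 < R" "mollifier R x \<noteq> 0"
  shows "R / 2 < norm x" "norm x < R"
proof -
  have "1/4 < (norm x)\<^sup>2 / R\<^sup>2" "(norm x)\<^sup>2 / R\<^sup>2 < 1"
    using assms(2) h_0[of "(norm x)\<^sup>2 / R\<^sup>2"] by (auto simp: mollifier_def not_le[symmetric])
  then have "(R / 2)\<^sup>2 < (norm x)\<^sup>2" "(norm x)\<^sup>2 < R\<^sup>2"
    using assms(1) by (simp_all add: field_simps power2_eq_square)
  then show "R / 2 < norm x" "norm x < R"
    using assms(1) power2_less_imp_less[OF _ norm_ge_zero, of "R / 2" x]
      power2_less_imp_less[of "norm x" R] by (blast, simp)
qed

text \<open>The heart of the proof. With \<open>K s = H s / s\<close>, the function
\<open>K (\<bar>z - w\<bar>\<^sup>2 / \<epsilon>\<^sup>2) / \<epsilon>\<^sup>2 \<cdot> cnj (z - w)\<close> is a smooth version of the Cauchy kernel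
\<open>1 / (z - w)\<close>: the two agree for \<open>\<bar>z - w\<bar> \<ge> \<epsilon>\<close>, and its derivative with respect to \<open>cnj z\<close> is
the mollifier centred at \<open>w\<close>. Multiplied with a cutoff around \<open>p\<close>, which is 1 where that
mollifier is nonzero and whose own derivative lives where the kernel is exactly \<open>1 / (z - w)\<close>,
its real and imaginary parts become test functions, and testing the weak equation with them gives
the identity. Its right-hand side does not depend on \<open>\<epsilon>\<close> and is holomorphic in \<open>w\<close>.\<close>
lemma weakly_holomorphic_kernel_identity:
  assumes f: "integrable lborel f" "weakly_holomorphic \<Omega> f"
    and R: "0 < R" "cball p R \<subseteq> \<Omega>" and w: "dist w p < R / 4" and \<epsilon>: "0 < \<epsilon>" "\<epsilon> \<le> R / 4"
  shows "(\<integral>z. f z * of_real (mollifier \<epsilon> (z - w)) \<partial>lborel) =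
    (\<integral>z. f z * of_real (mollifier R (z - p)) * complex_of_vec (z - p) /
            complex_of_vec (z - w) \<partial>lborel)"
proof -
  define K where "K s = H s / s" for s
  have smoothK: "real_C_k k K" for k
    unfolding K_def[abs_def] by (rule real_C_k_divide_by_argument[of "1/4"]) (use smooth H_0 in auto)
  then obtain K' where K': "(K has_real_derivative K' s) (at s)" for s
    using real_C_k.simps(2) by metis
  have HK: "H s = s * K s" for s using H_0[of 0] by (simp add: K_def)
  have hK: "h s = K s + s * K' s" for s
    by (rule DERIV_unique[OF deriv]) (use K'[of s] in \<open>auto simp: HK[abs_def] intro!: derivative_eq_intros\<close>)
  define P where "P z = (norm (z - p))\<^sup>2 / R\<^sup>2" for z
  define s where "s z = (norm (z - w))\<^sup>2 / \<epsilon>\<^sup>2" for z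
  define c where "c z = 1 - H (P z)" for z
  define A where "A z = c z * (K (s z) / \<epsilon>\<^sup>2)" for z
  \<comment> \<open>the regularised Cauchy kernel times the cutoff is \<open>\<eta> 1 - \<i> \<eta> 2\<close>\<close>
  define \<eta> where "\<eta> j z = A z * (z $ j - w $ j)" for j z
  define \<alpha> where "\<alpha> z = - 2 * h (P z) / R\<^sup>2 * (K (s z) / \<epsilon>\<^sup>2)" for z
  define \<beta> where "\<beta> z = 2 * c z * K' (s z) / \<epsilon>^4" for z
  have norm_sq: "(norm z)\<^sup>2 = z $ 1 * z $ 1 + z $ 2 * z $ 2" for z :: "real^2"
    by (simp add: power2_norm_eq_inner inner_vec_def sum_2)

  have "C_k_on k (\<eta> j) UNIV" for j k
  proof -
    have q: "C_k_on k (\<lambda>z. (norm (z - y))\<^sup>2 / r) UNIV" for y :: "real^2" and r :: real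
    proof -
      have "(\<lambda>z. (norm (z - y))\<^sup>2 / r) = (\<lambda>z. ((z $ 1 + - y $ 1) * (z $ 1 + - y $ 1) +
          (z $ 2 + - y $ 2) * (z $ 2 + - y $ 2)) * (1 / r))"
        by (rule ext) (simp add: norm_sq)
      then show ?thesis
        by (simp only:) (intro C_k_on_mult C_k_on_add C_k_on_const C_k_on_component open_UNIV)
    qed
    have "\<eta> j = (\<lambda>z. ((1 + - 1 * H (P z)) * (K (s z) * (1 / \<epsilon>\<^sup>2))) * (z $ j + - w $ j))"
      by (rule ext) (simp add: \<eta>_def A_def c_def)
    moreover have "C_k_on k \<dots> UNIV"
      by (intro C_k_on_mult C_k_on_add C_k_on_const C_k_on_component open_UNIV
          C_k_on_compose[OF _ smooth] C_k_on_compose[OF _ smoothK]) (simp_all add: P_def[abs_def] s_def[abs_def] q)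
    ultimately show ?thesis by simp
  qed
  moreover have "closure {z. \<eta> j z \<noteq> 0} \<subseteq> cball p R" for j
  proof (rule closure_minimal)
    have "P z \<ge> 1" if "z \<notin> cball p R" for z
      using that R(1) by (simp add: P_def dist_norm norm_minus_commute power_mono)
    then have "\<eta> j z = 0" if "z \<notin> cball p R" for z
      using that H_1 by (simp add: \<eta>_def A_def c_def)
    then show "{z. \<eta> j z \<noteq> 0} \<subseteq> cball p R"
      by blast
  qed simp
  moreover have "compact (closure {z. \<eta> j z \<noteq> 0})" if "closure {z. \<eta> j z \<noteq> 0} \<subseteq> cball p R" for j
    using bounded_subset[OF bounded_cball that] by (simp add: compact_eq_bounded_closed)
  ultimately have test: "\<eta> j \<in> test_functions \<Omega>" for j
    using R(2) unfolding test_functions_def C_infinity_on_def by blast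

  have "partial_deriv i (\<eta> j) z = (\<alpha> z * (z - p) $ i + \<beta> z * (z - w) $ i) * (z - w) $ j
      + A z * (if i = j then 1 else 0)" for i j z
  proof -
    have D: "((\<lambda>z. (norm (z - y))\<^sup>2 / r) has_derivative (\<lambda>v. 2 * ((z - y) \<bullet> v) / r)) (at z)"
      if "r \<noteq> 0" for y r
      unfolding power2_norm_eq_inner using that by (auto intro!: derivative_eq_intros simp: inner_commute)
    have DH: "((\<lambda>z. H (P z)) has_derivative (\<lambda>v. h (P z) * (2 * ((z - p) \<bullet> v) / R\<^sup>2))) (at z)"
      unfolding P_def[abs_def]
      by (rule has_derivative_compose[OF D deriv[unfolded has_field_derivative_def]]) (use R(1) in simp)
    have DK: "((\<lambda>z. K (s z)) has_derivative (\<lambda>v. K' (s z) * (2 * ((z - w) \<bullet> v) / \<epsilon>\<^sup>2))) (at z)"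
      unfolding s_def[abs_def]
      by (rule has_derivative_compose[OF D K'[unfolded has_field_derivative_def]]) (use \<epsilon>(1) in simp)
    have DZ: "((\<lambda>z. z $ j - w $ j) has_derivative (\<lambda>v. v $ j)) (at z)"
      by (rule has_derivative_eq_rhs[OF has_derivative_diff[OF
          bounded_linear_imp_has_derivative[OF bounded_linear_vec_nth] has_derivative_const]]) simp
    have "\<eta> j = (\<lambda>z. (1 - H (P z)) * (K (s z) * (1 / \<epsilon>\<^sup>2)) * (z $ j - w $ j))"
      by (rule ext) (simp add: \<eta>_def A_def c_def)
    then have "(\<eta> j has_derivative (\<lambda>v. (1 - H (P z)) * (K (s z) * (1 / \<epsilon>\<^sup>2)) * v $ j +
        ((1 - H (P z)) * (K' (s z) * (2 * ((z - w) \<bullet> v) / \<epsilon>\<^sup>2) * (1 / \<epsilon>\<^sup>2)) +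
        (0 - h (P z) * (2 * ((z - p) \<bullet> v) / R\<^sup>2)) * (K (s z) * (1 / \<epsilon>\<^sup>2))) * (z $ j - w $ j))) (at z)"
      by (simp only:) (rule has_derivative_mult[OF has_derivative_mult[OF has_derivative_diff[OF
          has_derivative_const DH] has_derivative_mult_left[OF DK]] DZ])
    then have pd: "partial_deriv i (\<eta> j) z =
        (1 - H (P z)) * (K (s z) * (1 / \<epsilon>\<^sup>2)) * axis i 1 $ j +
        ((1 - H (P z)) * (K' (s z) * (2 * ((z - w) \<bullet> axis i 1) / \<epsilon>\<^sup>2) * (1 / \<epsilon>\<^sup>2)) +
        (0 - h (P z) * (2 * ((z - p) \<bullet> axis i 1) / R\<^sup>2)) * (K (s z) * (1 / \<epsilon>\<^sup>2))) * (z $ j - w $ j)"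
      by (rule partial_deriv_eq)
    have ax: "axis i (1::real) $ j = (if i = j then 1 else 0)" by (simp add: axis_def)
    have inn: "y \<bullet> axis i 1 = y $ i" for y :: "real^2" by (simp add: inner_axis)
    show ?thesis
      unfolding pd ax inn \<alpha>_def \<beta>_def A_def c_def vector_minus_component
      by (simp add: algebra_simps add_divide_distrib diff_divide_distrib)
  qed
  note pd = this

  define J where "J z = of_real (h (s z) / \<epsilon>\<^sup>2) -
      of_real (h (P z) / R\<^sup>2) * complex_of_vec (z - p) / complex_of_vec (z - w)" for z
  have pointwise: "Complex (partial_deriv 1 (\<eta> 1) z) (partial_deriv 2 (\<eta> 1) z) -
      \<i> * Complex (partial_deriv 1 (\<eta> 2) z) (partial_deriv 2 (\<eta> 2) z) = 2 * J z" for z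
  proof -
    define Z Y where "Z = complex_of_vec (z - w)" and "Y = complex_of_vec (z - p)"
    have e1: "Complex (partial_deriv 1 (\<eta> 1) z) (partial_deriv 2 (\<eta> 1) z) -
      \<i> * Complex (partial_deriv 1 (\<eta> 2) z) (partial_deriv 2 (\<eta> 2) z)
      = of_real (\<alpha> z) * Y * cnj Z + of_real (\<beta> z) * (Z * cnj Z) + 2 * of_real (A z)"
      by (simp add: pd Z_def Y_def complex_eq_iff algebra_simps)
    have ZZ: "Z * cnj Z = of_real (s z * \<epsilon>\<^sup>2)"
      using \<epsilon>(1) by (simp add: s_def Z_def flip: complex_norm_square)
    have e2: "of_real (\<beta> z) * of_real (s z * \<epsilon>\<^sup>2) + 2 * of_real (A z) = (2 * of_real (h (s z) / \<epsilon>\<^sup>2) :: complex)"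
    proof -
      \<comment> \<open>the derivative of \<open>s K s = H s\<close> is \<open>h s\<close>\<close>
      have "\<beta> z * (s z * \<epsilon>\<^sup>2) + 2 * A z = 2 * (c z * (h (s z) / \<epsilon>\<^sup>2))"
        using \<epsilon>(1) by (simp add: \<beta>_def A_def hK field_simps power2_eq_square power4_eq_xxxx)
      moreover have "c z * (h (s z) / \<epsilon>\<^sup>2) = h (s z) / \<epsilon>\<^sup>2"
      \<comment> \<open>the mollifier is supported where the cutoff is 1\<close>
      proof (cases "s z < 1")
        case True
        then have "(norm (z - w))\<^sup>2 < \<epsilon>\<^sup>2" using \<epsilon>(1) by (simp add: s_def)
        then have "norm (z - w) < \<epsilon>" using \<epsilon>(1) power2_less_imp_less by fastforce
        then have "norm (z - p) \<le> R / 2"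
          using norm_triangle_ineq[of "z - w" "w - p"] w \<epsilon>(2) by (simp add: dist_norm)
        then have "(norm (z - p))\<^sup>2 \<le> (R / 2)\<^sup>2" by (intro power_mono) auto
        then have "P z \<le> 1 / 4" using R(1) by (simp add: P_def field_simps power2_eq_square)
        then show ?thesis using H_0 by (simp add: c_def)
      qed (use h_0 in simp)
      ultimately have "\<beta> z * (s z * \<epsilon>\<^sup>2) + 2 * A z = 2 * (h (s z) / \<epsilon>\<^sup>2)" by simp
      then show ?thesis
        by (metis (mono_tags, opaque_lifting) mult.assoc of_real_add of_real_mult of_real_numeral)
    qed
    have e3: "of_real (\<alpha> z) * Y * cnj Z = - 2 * (of_real (h (P z) / R\<^sup>2) * Y / Z)"
    \<comment> \<open>where the cutoff varies, \<open>z\<close> is farther than \<open>\<epsilon>\<close> from \<open>w\<close>\<close>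
    proof (cases "P z > 1/4")
      case True
      then have "(norm (z - p))\<^sup>2 > (R / 2)\<^sup>2" using R(1) by (simp add: P_def field_simps power2_eq_square)
      then have "norm (z - p) > R / 2" by (rule power2_less_imp_less) simp
      then have n: "norm (z - w) > \<epsilon>"
        using norm_triangle_ineq[of "z - w" "w - p"] w \<epsilon>(2) by (simp add: dist_norm)
      then have "(norm (z - w))\<^sup>2 > \<epsilon>\<^sup>2" using \<epsilon>(1) by (intro power_strict_mono) auto
      then have s1: "s z > 1" using \<epsilon>(1) by (simp add: s_def)
      have "Z \<noteq> 0" using n \<epsilon>(1) by (metis Z_def norm_complex_of_vec norm_zero not_less_iff_gr_or_eq order_less_trans)
      have "Z * cnj Z * of_real (K (s z) / \<epsilon>\<^sup>2) = 1"
        using s1 \<epsilon>(1) H_1[of "s z"] ZZ 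
        by (simp add: K_def flip: of_real_mult)
      then have "cnj Z * of_real (K (s z) / \<epsilon>\<^sup>2) = 1 / Z"
        using \<open>Z \<noteq> 0\<close> by (simp add: field_simps)
      moreover have "of_real (\<alpha> z) * Y * cnj Z = - 2 * of_real (h (P z) / R\<^sup>2) * Y * (cnj Z * of_real (K (s z) / \<epsilon>\<^sup>2))"
        by (simp add: \<alpha>_def)
      ultimately show ?thesis by simp
    qed (use h_0 in \<open>simp add: \<alpha>_def\<close>)
    show ?thesis
      unfolding e1 ZZ e3 add.assoc e2 by (simp add: J_def Z_def Y_def algebra_simps)
  qed
  obtain B where B: "\<And>s. \<bar>h s\<bar> \<le> B" using h_bounded by blast
  have int1: "integrable lborel (\<lambda>z. f z * of_real (h (s z) / \<epsilon>\<^sup>2))"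
  proof (rule integrable_mult_bounded[OF f(1)])
    show "(\<lambda>z. of_real (h (s z) / \<epsilon>\<^sup>2) :: complex) \<in> borel_measurable lborel"
      unfolding s_def by measurable
    show "norm (of_real (h (s z) / \<epsilon>\<^sup>2) :: complex) \<le> B / \<epsilon>\<^sup>2" for z
      using B by (simp add: norm_divide norm_power divide_right_mono)
  qed
  have int2: "integrable lborel (\<lambda>z. f z * (of_real (h (P z) / R\<^sup>2) * complex_of_vec (z - p) /
            complex_of_vec (z - w)))"
  proof (rule integrable_mult_bounded[OF f(1)])
    show "(\<lambda>z. of_real (h (P z) / R\<^sup>2) * complex_of_vec (z - p) / complex_of_vec (z - w))
        \<in> borel_measurable lborel"
      unfolding P_def by measurable
    show "norm (of_real (h (P z) / R\<^sup>2) * complex_of_vec (z - p) / complex_of_vec (z - w)) \<le> B / R\<^sup>2 * 4" for z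
    proof (cases "h (P z) = 0")
      case False
      then have n: "norm (z - p) > R / 2" "norm (z - p) < R"
        using mollifier_support[OF R(1), of "z - p"] R(1) by (auto simp: mollifier_def P_def)
      then have "norm (z - w) > R / 4"
        using norm_triangle_ineq[of "z - w" "w - p"] w by (simp add: dist_norm)
      then have "norm (z - p) / norm (z - w) \<le> R / (R / 4)"
        using n R(1) by (intro frac_le) auto
      then have "\<bar>h (P z)\<bar> / R\<^sup>2 * (norm (z - p) / norm (z - w)) \<le> B / R\<^sup>2 * 4"
        using B[of "P z"] R(1) by (intro mult_mono divide_right_mono) auto
      then show ?thesis by (simp add: norm_mult norm_divide norm_power)
    next
      case True
      then show ?thesis using B[of 0] by auto
    qed
  qed
  have cancel: "X = Y" if "0 = 2 * (X - Y)" for X Y :: complex using that by simp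
  have "0 = (\<integral>z. f z * Complex (partial_deriv 1 (\<eta> 1) z) (partial_deriv 2 (\<eta> 1) z) \<partial>lborel) -
      \<i> * (\<integral>z. f z * Complex (partial_deriv 1 (\<eta> 2) z) (partial_deriv 2 (\<eta> 2) z) \<partial>lborel)"
    using f(2) test by (simp add: weakly_holomorphic_def)
  also have "\<dots> = (\<integral>z. f z * Complex (partial_deriv 1 (\<eta> 1) z) (partial_deriv 2 (\<eta> 1) z) -
      \<i> * (f z * Complex (partial_deriv 1 (\<eta> 2) z) (partial_deriv 2 (\<eta> 2) z)) \<partial>lborel)"
    using integrable_mult_gradient[OF f(1) test] by simp
  also have "\<dots> = (\<integral>z. 2 * (f z * of_real (h (s z) / \<epsilon>\<^sup>2) -
      f z * (of_real (h (P z) / R\<^sup>2) * complex_of_vec (z - p) / complex_of_vec (z - w))) \<partial>lborel)"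
  proof (rule Bochner_Integration.integral_cong[OF refl])
    fix z
    have "f z * Complex (partial_deriv 1 (\<eta> 1) z) (partial_deriv 2 (\<eta> 1) z) -
      \<i> * (f z * Complex (partial_deriv 1 (\<eta> 2) z) (partial_deriv 2 (\<eta> 2) z)) = f z * (2 * J z)"
      unfolding pointwise[symmetric] by (simp add: algebra_simps)
    then show "f z * Complex (partial_deriv 1 (\<eta> 1) z) (partial_deriv 2 (\<eta> 1) z) -
      \<i> * (f z * Complex (partial_deriv 1 (\<eta> 2) z) (partial_deriv 2 (\<eta> 2) z)) =
      2 * (f z * of_real (h (s z) / \<epsilon>\<^sup>2) -
      f z * (of_real (h (P z) / R\<^sup>2) * complex_of_vec (z - p) / complex_of_vec (z - w)))"
      by (simp add: J_def algebra_simps)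
  qed
  also have "\<dots> = 2 * ((\<integral>z. f z * of_real (h (s z) / \<epsilon>\<^sup>2) \<partial>lborel) -
      (\<integral>z. f z * (of_real (h (P z) / R\<^sup>2) * complex_of_vec (z - p) / complex_of_vec (z - w)) \<partial>lborel))"
    by (simp only: integral_mult_right_zero Bochner_Integration.integral_diff[OF int1 int2])
  finally have "(\<integral>z. f z * of_real (h (s z) / \<epsilon>\<^sup>2) \<partial>lborel) =
      (\<integral>z. f z * (of_real (h (P z) / R\<^sup>2) * complex_of_vec (z - p) / complex_of_vec (z - w)) \<partial>lborel)"
    by (rule cancel)
  then show ?thesis by (simp only: P_def s_def mollifier_def mult.assoc times_divide_eq_right)
qed

end

section \<open>Cauchy transforms and integrals over boxes\<close>

text \<open>Off the ball around \<open>p\<close> the kernel is a geometric series in \<open>(w - p) / (a z - p)\<close> that converges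
uniformly in \<open>z\<close>, so that term-by-term integration gives a power series in \<open>w - p\<close>.\<close>
lemma cauchy_transform_holomorphic:
  fixes \<rho> a :: "'a \<Rightarrow> complex"
  assumes \<rho>: "integrable M \<rho>" and a: "a \<in> borel_measurable M"
    and r: "0 < r" and far: "\<And>z. \<rho> z \<noteq> 0 \<Longrightarrow> norm (a z - p) \<ge> r"
  shows "(\<lambda>w. \<integral>z. \<rho> z / (a z - w) \<partial>M) holomorphic_on ball p r"
proof (rule power_series_holomorphic)
  fix w assume "w \<in> ball p r"
  then have w: "norm (w - p) < r" by (simp add: dist_norm norm_minus_commute)
  define q where "q = norm (w - p) / r"
  have q: "0 \<le> q" "q < 1" using w r by (auto simp: q_def)
  define F where "F n z = \<rho> z / (a z - p) ^ Suc n * (w - p) ^ n" for n z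
  note [measurable] = a borel_measurable_integrable[OF \<rho>]
  have bound: "norm (F n z) \<le> norm (\<rho> z) / r * q ^ n" for n z
  proof (cases "\<rho> z = 0")
    case False
    then have "r ^ Suc n \<le> norm (a z - p) ^ Suc n" using far r by (intro power_mono) auto
    then have "norm (\<rho> z) * norm (w - p) ^ n / norm (a z - p) ^ Suc n \<le> norm (\<rho> z) * norm (w - p) ^ n / r ^ Suc n"
      using r by (intro divide_left_mono) (auto intro!: mult_pos_pos zero_less_power less_le_trans[OF r far[OF False]])
    moreover have "norm (F n z) = norm (\<rho> z) * norm (w - p) ^ n / norm (a z - p) ^ Suc n"
      by (simp only: F_def norm_mult norm_divide norm_power) simp
    moreover have "norm (\<rho> z) * norm (w - p) ^ n / r ^ Suc n = norm (\<rho> z) / r * q ^ n"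
      by (simp add: q_def power_divide)
    ultimately show ?thesis by simp
  qed (simp add: F_def)
  have int: "integrable M (F n)" for n
  proof (rule Bochner_Integration.integrable_bound)
    show "integrable M (\<lambda>z. norm (\<rho> z) / r * q ^ n)" using \<rho> by auto
    show "F n \<in> borel_measurable M" unfolding F_def by measurable
    show "AE z in M. norm (F n z) \<le> norm (norm (\<rho> z) / r * q ^ n)"
      using bound r q by (auto intro!: AE_I2)
  qed
  have geo: "F n z = \<rho> z / (a z - p) * ((w - p) / (a z - p)) ^ n" for n z
    by (simp add: F_def power_divide field_simps)
  have sum: "(\<lambda>n. F n z) sums (\<rho> z / (a z - w))" for z
  proof (cases "\<rho> z = 0")
    case False
    then have n: "norm (a z - p) \<ge> r" by (rule far)
    then have nz: "a z - p \<noteq> 0" using r by auto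
    have "norm ((w - p) / (a z - p)) < 1"
      using n w r nz by (simp add: norm_divide)
    from geometric_sums[OF this] have "(\<lambda>n. F n z) sums (\<rho> z / (a z - p) * (1 / (1 - (w - p) / (a z - p))))"
      unfolding geo by (rule sums_mult)
    also have "\<rho> z / (a z - p) * (1 / (1 - (w - p) / (a z - p))) = \<rho> z / (a z - w)"
      using nz by (simp add: divide_simps)
    finally show ?thesis .
  qed (simp add: F_def)
  have sq: "summable (\<lambda>n. c * q ^ n)" for c
    using q by (intro summable_mult summable_geometric) auto
  have "(\<lambda>n. \<integral>z. F n z \<partial>M) sums (\<integral>z. (\<Sum>n. F n z) \<partial>M)"
  proof (rule sums_integral[OF int])
    show "AE z in M. summable (\<lambda>n. norm (F n z))"
    proof (intro AE_I2)
      show "summable (\<lambda>n. norm (F n z))" for z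
        by (rule summable_comparison_test'[OF sq[of "norm (\<rho> z) / r"]]) (use bound in auto)
    qed
    show "summable (\<lambda>n. \<integral>z. norm (F n z) \<partial>M)"
    proof (rule summable_comparison_test'[OF sq])
      fix n
      have "(\<integral>z. norm (F n z) \<partial>M) \<le> (\<integral>z. norm (\<rho> z) / r * q ^ n \<partial>M)"
        using int \<rho> bound by (intro integral_mono) auto
      then show "norm (\<integral>z. norm (F n z) \<partial>M) \<le> (\<integral>z. norm (\<rho> z) \<partial>M) / r * q ^ n"
        by simp
    qed
  qed
  moreover have "(\<Sum>n. F n z) = \<rho> z / (a z - w)" for z
    using sum sums_unique by metis
  moreover have "(\<integral>z. F n z \<partial>M) = (\<integral>z. \<rho> z / (a z - p) ^ Suc n \<partial>M) * (w - p) ^ n" for n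
    unfolding F_def by (rule integral_mult_left_zero)
  ultimately show "(\<lambda>n. (\<integral>z. \<rho> z / (a z - p) ^ Suc n \<partial>M) * (w - p) ^ n) sums (\<integral>z. \<rho> z / (a z - w) \<partial>M)"
    by simp
qed

text \<open>Boxes form an intersection-stable generator of the Borel sets, so the integral of \<open>u\<close> vanishes
over every Borel set.\<close>
lemma AE_zero_if_box_integrals_zero:
  fixes u :: "'a::euclidean_space \<Rightarrow> 'b::{banach,second_countable_topology}"
  assumes u: "integrable lborel u" and box: "\<And>a b. set_lebesgue_integral lborel (box a b) u = 0"
  shows "AE x in lborel. u x = 0"
proof -
  have si: "set_integrable lborel A u" if "A \<in> sets borel" for A
    using u that unfolding set_integrable_def by (intro integrable_mult_indicator) auto
  let ?G = "range (\<lambda>(a, b). box a b :: 'a set)"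
  have total: "set_lebesgue_integral lborel UNIV u = 0"
  proof -
    have "(\<lambda>n. set_lebesgue_integral lborel (box (- real n *\<^sub>R One) (real n *\<^sub>R One)) u)
        \<longlonglongrightarrow> set_lebesgue_integral lborel (\<Union>n. box (- real n *\<^sub>R One) (real n *\<^sub>R One)) u"
      by (rule set_integral_cont_up) (auto simp: incseq_def box_def inner_simps intro!: si)
    then show ?thesis
      using UN_box_eq_UNIV[where ?'a = 'a] by (simp add: box LIMSEQ_const_iff)
  qed
  have "set_lebesgue_integral lborel A u = 0" if "A \<in> sets borel" for A
  proof -
    have "Int_stable ?G"
      by (auto simp: Int_stable_def box_Int_box)
    moreover have "?G \<subseteq> Pow UNIV" by simp
    moreover have "A \<in> sigma_sets UNIV ?G"
      using that by (simp add: borel_eq_box)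
    ultimately show ?thesis
    proof (induction rule: sigma_sets_induct_disjoint)
      case (compl A)
      then have A: "A \<in> sets borel" by (simp add: borel_eq_box)
      have "set_lebesgue_integral lborel (A \<union> (UNIV - A)) u =
          set_lebesgue_integral lborel A u + set_lebesgue_integral lborel (UNIV - A) u"
        using A by (intro set_integral_Un si) auto
      then show ?case using total compl.IH by simp
    next
      case (union A)
      then have A: "A i \<in> sets borel" for i by (auto simp: borel_eq_box)
      have "set_lebesgue_integral lborel (\<Union>i. A i) u = (\<Sum>i. set_lebesgue_integral lborel (A i) u)"
        by (rule lebesgue_integral_countable_add)
          (use A union in \<open>auto simp: disjoint_family_on_def intro!: si\<close>)
      then show ?case using union by simp
    qed (use box in \<open>auto simp: set_lebesgue_integral_def\<close>)
  qed
  then show ?thesis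
    by (intro sigma_finite_measure.density_zero[OF sigma_finite_lborel u]) simp
qed

section \<open>Mollification\<close>

lemma AE_not_in_box_frontier: "AE x in lborel. x \<notin> cbox a b - box a (b::'a::euclidean_space)"
proof -
  have "emeasure lborel (cbox a b - box a b) = 0"
    by (subst emeasure_Diff) (auto simp: emeasure_lborel_cbox_eq emeasure_lborel_box_eq box_subset_cbox)
  then show ?thesis by (intro AE_not_in) (auto simp: null_sets_def)
qed

context smooth_cutoff
begin

definition mass :: real
  where "mass = (\<integral>x. mollifier 1 x \<partial>lborel)"

lemma mollifier_measurable [measurable]: "mollifier \<epsilon> \<in> borel_measurable borel"
  unfolding mollifier_def by measurable

lemma mollifier_nonneg: "mollifier \<epsilon> x \<ge> 0"
  by (simp add: mollifier_def h_nonneg)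

lemma mollifier_bounded: obtains B where "\<And>x. \<bar>mollifier \<epsilon> x\<bar> \<le> B"
proof -
  obtain B where "\<And>s. \<bar>h s\<bar> \<le> B" using h_bounded by blast
  then have "\<bar>mollifier \<epsilon> x\<bar> \<le> B / \<epsilon>\<^sup>2" for x
    by (simp add: mollifier_def divide_right_mono)
  then show ?thesis by (rule that)
qed

lemma integrable_mollifier: "integrable lborel (mollifier 1)"
proof -
  obtain B where B: "\<And>x. \<bar>mollifier 1 x\<bar> \<le> B" using mollifier_bounded by blast
  show ?thesis
  proof (rule Bochner_Integration.integrable_bound)
    have "integrable lborel (indicator (cball 0 1) :: real^2 \<Rightarrow> real)"
      by (intro integrable_real_indicator) (use emeasure_bounded_finite[of "cball (0::real^2) 1"] in auto)
    then show "integrable lborel (\<lambda>x::real^2. B * indicator (cball 0 1) x :: real)"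
      by (intro integrable_mult_right)
    have "\<bar>mollifier 1 x\<bar> \<le> B * indicator (cball 0 1) x" for x
      using B[of x] h_0[of "(norm x)\<^sup>2"] by (cases "norm x \<le> 1") (auto simp: mollifier_def)
    then show "AE x in lborel. norm (mollifier 1 x) \<le> norm (B * indicator (cball 0 1) x)"
      by (intro AE_I2) (metis abs_ge_self order_trans real_norm_def)
  qed simp
qed

lemma mass_pos: "mass > 0"
proof (rule ccontr)
  assume "\<not> mass > 0"
  moreover have "mass \<ge> 0"
    unfolding mass_def by (intro Bochner_Integration.integral_nonneg mollifier_nonneg)
  ultimately have "(\<integral>x. mollifier 1 x \<partial>lborel) = 0" by (simp add: mass_def)
  then have ae: "AE x in lborel. mollifier 1 x = 0"
    using integral_nonneg_eq_0_iff_AE[OF integrable_mollifier] mollifier_nonneg by auto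
  let ?S = "ball (0::real^2) 1 - cball 0 (1/2)"
  have "mollifier 1 x > 0" if "x \<in> ?S" for x
  proof -
    have "(norm x)\<^sup>2 > (1/2)\<^sup>2" using that by (intro power_strict_mono) auto
    moreover have "(norm x)\<^sup>2 < 1\<^sup>2" using that by (intro power_strict_mono) auto
    ultimately show ?thesis by (simp add: mollifier_def h_pos power2_eq_square)
  qed
  then have "x \<notin> ?S" if "mollifier 1 x = 0" for x using that by (metis less_irrefl)
  with ae have "AE x in lborel. x \<notin> ?S" by (rule eventually_mono)
  then have "?S \<in> null_sets lborel" by (subst (asm) AE_iff_null_sets[symmetric]) auto
  then have "negligible ?S" by (simp add: negligible_iff_null_sets null_sets_completionI)
  moreover have "open ?S" by (intro open_Diff) auto
  moreover have "(3/4) *\<^sub>R axis 1 1 \<in> ?S" by simp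
  ultimately show False using open_not_negligible by blast
qed

lemma integral_mollifier_substitution:
  assumes "\<epsilon> > 0" and F: "F \<in> borel_measurable borel"
  shows "(\<integral>w. F w * mollifier \<epsilon> (z - w) \<partial>lborel) = (\<integral>t. F (z - \<epsilon> *\<^sub>R t) * mollifier 1 t \<partial>lborel)"
proof -
  note [measurable] = F
  have "(\<integral>w. F w * mollifier \<epsilon> (z - w) \<partial>lborel) = (\<integral>w. F w * mollifier \<epsilon> (z - w)
      \<partial>density (distr lborel borel (\<lambda>t. z + (- \<epsilon>) *\<^sub>R t)) (\<lambda>_. \<bar>- \<epsilon>\<bar> ^ DIM(real^2)))"
    using assms(1) by (subst lborel_affine[of "- \<epsilon>" z]) auto
  also have "\<dots> = (\<integral>t. \<epsilon>\<^sup>2 * (F (z - \<epsilon> *\<^sub>R t) * mollifier \<epsilon> (\<epsilon> *\<^sub>R t)) \<partial>lborel)"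
    using assms(1) by (subst integral_density) (auto simp: integral_distr)
  also have "\<dots> = (\<integral>t. F (z - \<epsilon> *\<^sub>R t) * mollifier 1 t \<partial>lborel)"
    using assms(1) by (intro Bochner_Integration.integral_cong refl) (simp add: mollifier_def power_mult_distrib)
  finally show ?thesis .
qed

text \<open>Exchanging the integrations moves the mollifier from \<open>f\<close> to the indicator of the box. The
mollified indicator is bounded by the mass and converges to a multiple of the indicator off the
boundary of the box, so dominated convergence recovers the integral of \<open>f\<close>.\<close>
lemma integral_box_eq_if_mollification_eq:
  fixes f g :: "real^2 \<Rightarrow> complex"
  assumes f: "integrable lborel f" and N: "N > 0"
    and eq: "\<And>n w. n \<ge> N \<Longrightarrow> w \<in> box a b \<Longrightarrow>
      (\<integral>z. f z * of_real (mollifier (1 / real n) (z - w)) \<partial>lborel) = of_real mass * g w"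
  shows "set_lebesgue_integral lborel (box a b) f = set_lebesgue_integral lborel (box a b) g"
proof -
  let ?B = "box a b"
  note [measurable] = borel_measurable_integrable[OF f]
  define J where "J n z = (\<integral>w. indicator ?B w * mollifier (1 / real n) (z - w) \<partial>lborel)" for n z
  have J_eq: "J n z = (\<integral>t. indicator ?B (z - (1 / real n) *\<^sub>R t) * mollifier 1 t \<partial>lborel)" if "n \<ge> N" for n z
    unfolding J_def using that N by (intro integral_mollifier_substitution) auto
  have int_ind: "integrable lborel (\<lambda>t. indicator ?B (z - r *\<^sub>R t) * mollifier 1 t)" for z r
    by (rule Bochner_Integration.integrable_bound[OF integrable_mollifier]) (auto simp: indicator_def)
  have J_bound: "\<bar>J n z\<bar> \<le> mass" if "n \<ge> N" for n z
  proof -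
    have "0 \<le> J n z" unfolding J_def by (intro Bochner_Integration.integral_nonneg mult_nonneg_nonneg mollifier_nonneg) simp
    moreover have "J n z \<le> mass"
      unfolding J_eq[OF that] mass_def
      by (intro integral_mono int_ind integrable_mollifier) (auto simp: indicator_def mollifier_nonneg)
    ultimately show ?thesis by simp
  qed
  have J_meas [measurable]: "J n \<in> borel_measurable borel" for n
    unfolding J_def by measurable
  have J_lim: "(\<lambda>n. J n z) \<longlonglongrightarrow> mass * indicator ?B z" if z: "z \<notin> cbox a b - box a b" for z
  proof -
    have "(\<lambda>n. \<integral>t. indicator ?B (z - (1 / real n) *\<^sub>R t) * mollifier 1 t \<partial>lborel)
        \<longlonglongrightarrow> (\<integral>t. indicator ?B z * mollifier 1 t \<partial>lborel)"
    proof (rule integral_dominated_convergence[where w = "mollifier 1"])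
      show "AE t in lborel. (\<lambda>n. indicator ?B (z - (1 / real n) *\<^sub>R t) * mollifier 1 t)
          \<longlonglongrightarrow> indicator ?B z * mollifier 1 t"
      proof (intro AE_I2 tendsto_mult tendsto_const)
        fix t
        have lim: "(\<lambda>n. z - (1 / real n) *\<^sub>R t) \<longlonglongrightarrow> z"
          by (auto intro!: tendsto_eq_intros lim_const_over_n)
        have "\<forall>\<^sub>F n in sequentially. indicator ?B (z - (1 / real n) *\<^sub>R t) = (indicator ?B z :: real)"
        proof (cases "z \<in> ?B")
          case True
          then show ?thesis
            by (intro eventually_mono[OF topological_tendstoD[OF lim open_box True]]) (simp add: indicator_def)
        next
          case False
          then have "z \<in> - cbox a b" using z by auto
          then have "\<forall>\<^sub>F n in sequentially. z - (1 / real n) *\<^sub>R t \<in> - cbox a b"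
            using topological_tendstoD[OF lim, of "- cbox a b"] by (auto simp: closed_cbox open_Compl)
          then show ?thesis
            by (rule eventually_mono) (use False box_subset_cbox[of a b] in \<open>auto simp: indicator_def\<close>)
        qed
        then show "(\<lambda>n. indicator ?B (z - (1 / real n) *\<^sub>R t) :: real) \<longlonglongrightarrow> indicator ?B z"
          by (rule tendsto_eventually)
      qed
      show "AE t in lborel. norm (indicator ?B (z - (1 / real n) *\<^sub>R t) * mollifier 1 t) \<le> mollifier 1 t" for n
        by (auto simp: indicator_def mollifier_nonneg)
    qed (use integrable_mollifier in auto)
    then have "(\<lambda>n. \<integral>t. indicator ?B (z - (1 / real n) *\<^sub>R t) * mollifier 1 t \<partial>lborel)
        \<longlonglongrightarrow> mass * indicator ?B z"
      by (simp add: mass_def mult.commute)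
    then show ?thesis
      by (rule Lim_transform_eventually) (rule eventually_mono[OF eventually_ge_at_top[of N]], simp add: J_eq)
  qed
  have swap: "(\<integral>z. f z * of_real (J n z) \<partial>lborel) = of_real mass * set_lebesgue_integral lborel ?B g"
    if n: "n \<ge> N" for n
  proof -
    obtain C where C: "\<And>x. \<bar>mollifier (1 / real n) x\<bar> \<le> C" using mollifier_bounded by blast
    define F where "F z w = f z * of_real (indicator ?B w * mollifier (1 / real n) (z - w))" for z w
    have [measurable]: "(\<lambda>(z, w). F z w) \<in> borel_measurable (lborel \<Otimes>\<^sub>M lborel)"
      unfolding F_def by measurable
    have int_k: "integrable lborel (\<lambda>w. indicator ?B w * mollifier (1 / real n) (z - w))" for z
      by (rule integrable_mult_bounded[where B = C]) (use C emeasure_bounded_finite[OF bounded_box, of a b] in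
          \<open>auto intro!: integrable_real_indicator\<close>)
    have int_k': "integrable lborel (\<lambda>w. of_real (indicator ?B w * mollifier (1 / real n) (z - w)) :: complex)" for z
      using int_k by (rule integrable_of_real)
    have inner_z: "(\<integral>w. F z w \<partial>lborel) = f z * of_real (J n z)" for z
      unfolding F_def J_def by (simp del: of_real_mult add: integral_complex_of_real)
    have "integrable (lborel \<Otimes>\<^sub>M lborel) (\<lambda>(z, w). F z w)"
    proof (rule lborel_pair.Fubini_integrable)
      have "norm (F z w) = norm (f z) * (indicator ?B w * mollifier (1 / real n) (z - w))" for z w
        by (simp add: F_def norm_mult mollifier_nonneg abs_mult)
      then have "(\<integral>w. norm (F z w) \<partial>lborel) = norm (f z) * J n z" for z
        by (simp add: J_def)
      moreover have "integrable lborel (\<lambda>z. norm (f z) * J n z)"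
        by (rule integrable_mult_bounded[where B = mass]) (use f J_bound[OF n] in auto)
      ultimately show "integrable lborel (\<lambda>z. \<integral>w. norm (case (z, w) of (z, w) \<Rightarrow> F z w) \<partial>lborel)"
        by simp
      show "AE z in lborel. integrable lborel (\<lambda>w. case (z, w) of (z, w) \<Rightarrow> F z w)"
        using int_k' by (simp add: F_def del: of_real_mult)
    qed simp
    then have "(\<integral>z. (\<integral>w. F z w \<partial>lborel) \<partial>lborel) = (\<integral>w. (\<integral>z. F z w \<partial>lborel) \<partial>lborel)"
      by (rule lborel_pair.Fubini_integral[symmetric])
    also have "\<dots> = (\<integral>w. of_real mass * (indicator ?B w *\<^sub>R g w) \<partial>lborel)"
    proof (rule Bochner_Integration.integral_cong[OF refl])
      fix w
      show "(\<integral>z. F z w \<partial>lborel) = of_real mass * (indicator ?B w *\<^sub>R g w)"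
        using eq[OF n, of w] by (cases "w \<in> ?B") (simp_all add: F_def)
    qed
    finally show ?thesis
      unfolding inner_z set_lebesgue_integral_def integral_mult_right_zero .
  qed
  have "(\<lambda>n. \<integral>z. f z * of_real (J (n + N) z) \<partial>lborel) \<longlonglongrightarrow> (\<integral>z. f z * of_real (mass * indicator ?B z) \<partial>lborel)"
  proof (rule integral_dominated_convergence[where w = "\<lambda>z. norm (f z) * mass"])
    show "AE z in lborel. (\<lambda>n. f z * of_real (J (n + N) z)) \<longlonglongrightarrow> f z * of_real (mass * indicator ?B z)"
      using AE_not_in_box_frontier[of a b]
      by eventually_elim (intro tendsto_mult tendsto_const tendsto_of_real LIMSEQ_ignore_initial_segment J_lim)
    show "AE z in lborel. norm (f z * of_real (J (n + N) z)) \<le> norm (f z) * mass" for n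
      using J_bound[of "n + N"] by (auto simp: norm_mult intro!: mult_left_mono)
  qed (use f in auto)
  then have "(\<integral>z. f z * of_real (mass * indicator ?B z) \<partial>lborel) = of_real mass * set_lebesgue_integral lborel ?B g"
    using swap by (simp add: LIMSEQ_const_iff)
  moreover have "(\<integral>z. f z * of_real (mass * indicator ?B z) \<partial>lborel) = (\<integral>z. of_real mass * (indicator ?B z *\<^sub>R f z) \<partial>lborel)"
    by (intro Bochner_Integration.integral_cong refl) (auto simp: indicator_def)
  ultimately have "of_real mass * set_lebesgue_integral lborel ?B f = of_real mass * set_lebesgue_integral lborel ?B g"
    unfolding set_lebesgue_integral_def integral_mult_right_zero by argo
  then show ?thesis using mass_pos by simp
qed

end

section \<open>Weyl's lemma\<close>

definition vec_of_complex :: "complex \<Rightarrow> real^2"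
  where "vec_of_complex \<zeta> = vector [Re \<zeta>, Im \<zeta>]"

lemma complex_of_vec_inverse [simp]: "complex_of_vec (vec_of_complex \<zeta>) = \<zeta>"
  and vec_of_complex_inverse [simp]: "vec_of_complex (complex_of_vec z) = z"
  by (simp_all add: vec_of_complex_def complex_eq_iff vec_eq_iff forall_2)

context smooth_cutoff
begin

text \<open>The mollification is the Cauchy transform of \<open>f\<close> weighted on an annulus around \<open>p\<close>, whatever
small radius is used for the mollifier.\<close>
lemma weakly_holomorphic_mollification_holomorphic:
  assumes f: "integrable lborel f" "weakly_holomorphic \<Omega> f" and R: "0 < R" "cball p R \<subseteq> \<Omega>"
  obtains g where "g holomorphic_on ball (complex_of_vec p) (R / 4)"
    "\<And>\<epsilon> w. \<lbrakk>0 < \<epsilon>; \<epsilon> \<le> R / 4; dist w p < R / 4\<rbrakk> \<Longrightarrow>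
       (\<integral>z. f z * of_real (mollifier \<epsilon> (z - w)) \<partial>lborel) = g (complex_of_vec w)"
proof -
  define \<rho> where "\<rho> z = f z * (of_real (mollifier R (z - p)) * complex_of_vec (z - p))" for z
  define g where "g \<zeta> = (\<integral>z. \<rho> z / (complex_of_vec z - \<zeta>) \<partial>lborel)" for \<zeta>
  obtain B where B: "\<And>x. \<bar>mollifier R x\<bar> \<le> B" using mollifier_bounded by blast
  have "integrable lborel \<rho>"
    unfolding \<rho>_def
  proof (rule integrable_mult_bounded[OF f(1)])
    show "norm (of_real (mollifier R (z - p)) * complex_of_vec (z - p)) \<le> B * R" for z
    proof (cases "mollifier R (z - p) = 0")
      case False
      then show ?thesis
        using mollifier_support[OF R(1), of "z - p"] B[of "z - p"] B[of 0]
        by (simp add: norm_mult mult_mono)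
    qed (use B[of 0] R(1) in simp)
  qed measurable
  moreover have "norm (complex_of_vec z - complex_of_vec p) \<ge> R / 2" if "\<rho> z \<noteq> 0" for z
    using mollifier_support[OF R(1), of "z - p"] that by (auto simp: \<rho>_def simp flip: complex_of_vec_diff)
  ultimately have "g holomorphic_on ball (complex_of_vec p) (R / 2)"
    unfolding g_def using R(1) by (intro cauchy_transform_holomorphic) auto
  then have "g holomorphic_on ball (complex_of_vec p) (R / 4)"
    by (rule holomorphic_on_subset) (use R(1) in \<open>auto intro: subset_ball\<close>)
  moreover have "(\<integral>z. f z * of_real (mollifier \<epsilon> (z - w)) \<partial>lborel) = g (complex_of_vec w)"
    if "0 < \<epsilon>" "\<epsilon> \<le> R / 4" "dist w p < R / 4" for \<epsilon> w
    unfolding weakly_holomorphic_kernel_identity[OF f R that(3,1,2)] g_def \<rho>_def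
    by (simp add: mult.assoc complex_of_vec_diff)
  ultimately show ?thesis by (rule that)
qed

text \<open>Locally the mollifications are eventually constant, hence their limit exists on the whole of
\<open>\<Omega>\<close> and is holomorphic. It agrees with \<open>f\<close> almost everywhere near
each point, and countably many such neighbourhoods cover \<open>\<Omega>\<close>.\<close>
lemma weakly_holomorphic_imp_AE_eq_holomorphic:
  assumes f: "integrable lborel f" "weakly_holomorphic \<Omega> f" and \<Omega>: "open \<Omega>"
  obtains G where "G holomorphic_on complex_of_vec ` \<Omega>"
    "AE z in lborel. z \<in> \<Omega> \<longrightarrow> f z = G (complex_of_vec z)"
proof -
  define m where "m n w = (\<integral>z. f z * of_real (mollifier (1 / real n) (z - w)) \<partial>lborel)" for n w
  define G where "G \<zeta> = lim (\<lambda>n. m n (vec_of_complex \<zeta>)) / of_real mass" for \<zeta>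
  have local: "\<exists>R>0. G holomorphic_on ball (complex_of_vec p) R \<and>
      (\<exists>N>0. \<forall>n\<ge>N. \<forall>w\<in>ball p R. m n w = of_real mass * G (complex_of_vec w))" if p: "p \<in> \<Omega>" for p
  proof -
    obtain R where R: "0 < R" "cball p R \<subseteq> \<Omega>" using \<Omega> p open_contains_cball by blast
    obtain g where g: "g holomorphic_on ball (complex_of_vec p) (R / 4)"
      "\<And>\<epsilon> w. \<lbrakk>0 < \<epsilon>; \<epsilon> \<le> R / 4; dist w p < R / 4\<rbrakk> \<Longrightarrow>
       (\<integral>z. f z * of_real (mollifier \<epsilon> (z - w)) \<partial>lborel) = g (complex_of_vec w)"
      using weakly_holomorphic_mollification_holomorphic[OF f R] by blast
    obtain N where N: "N > 0" "1 / real N < R / 4"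
      using R(1) real_arch_inverse[of "R / 4"] by (auto simp: inverse_eq_divide)
    have mg: "m n w = g (complex_of_vec w)" if "n \<ge> N" "dist w p < R / 4" for n w
    proof -
      have "1 / real n \<le> 1 / real N" using N that by (intro divide_left_mono) auto
      then show ?thesis unfolding m_def using N that by (intro g(2)) auto
    qed
    have Gg: "G (complex_of_vec w) = g (complex_of_vec w) / of_real mass" if "dist w p < R / 4" for w
    proof -
      have "(\<lambda>n. m n w) \<longlonglongrightarrow> g (complex_of_vec w)"
        by (rule tendsto_eventually) (use mg that in \<open>auto simp: eventually_at_top_linorder\<close>)
      then show ?thesis by (simp add: G_def limI)
    qed
    have "(\<lambda>\<zeta>. g \<zeta> / of_real mass) holomorphic_on ball (complex_of_vec p) (R / 4)"
      using g(1) mass_pos by (intro holomorphic_intros) auto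
    moreover have "G \<zeta> = g \<zeta> / of_real mass" if "\<zeta> \<in> ball (complex_of_vec p) (R / 4)" for \<zeta>
      using Gg[of "vec_of_complex \<zeta>"] that dist_complex_of_vec[of "vec_of_complex \<zeta>" p]
      by (simp add: dist_commute)
    ultimately have "G holomorphic_on ball (complex_of_vec p) (R / 4)"
      using holomorphic_transform by (metis (no_types, lifting))
    moreover have "m n w = of_real mass * G (complex_of_vec w)" if "n \<ge> N" "w \<in> ball p (R / 4)" for n w
      using mg[OF that(1)] Gg that(2) mass_pos by (simp add: dist_commute)
    ultimately show ?thesis using R(1) N(1) by (intro exI[of _ "R / 4"]) auto
  qed
  have hol: "G holomorphic_on complex_of_vec ` \<Omega>"
    by (rule analytic_imp_holomorphic, unfold analytic_on_def) (use local in blast)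
  have "\<exists>U. open U \<and> p \<in> U \<and> (AE z in lborel. z \<in> U \<longrightarrow> f z = G (complex_of_vec z))" if p: "p \<in> \<Omega>" for p
  proof -
    obtain R N where R: "R > 0" "G holomorphic_on ball (complex_of_vec p) R" and N: "N > 0"
      and m: "\<And>n w. n \<ge> N \<Longrightarrow> w \<in> ball p R \<Longrightarrow> m n w = of_real mass * G (complex_of_vec w)"
      using local[OF p] by blast
    obtain a b where ab: "p \<in> box a b" "cbox a b \<subseteq> ball p R"
      using open_contains_cbox[OF open_ball, of p p R] R(1) by (metis centre_in_ball)
    let ?U = "box a b" and ?g = "\<lambda>z. G (complex_of_vec z)"
    have "continuous_on (cbox a b) ?g"
    proof (rule continuous_on_compose2[OF holomorphic_on_imp_continuous_on[OF R(2)]])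
      show "complex_of_vec ` cbox a b \<subseteq> ball (complex_of_vec p) R"
        using ab(2) by (auto simp: dist_complex_of_vec)
    qed (intro continuous_intros)
    then have gi: "set_integrable lborel (cbox a b) ?g"
      unfolding set_integrable_def by (intro borel_integrable_compact compact_cbox)
    have g_int: "set_integrable lborel A ?g" if "A \<in> sets borel" "A \<subseteq> cbox a b" for A
      by (rule set_integrable_subset[OF gi _ that(2)]) (simp add: that(1))
    have f_int: "set_integrable lborel A f" if "A \<in> sets borel" for A
      unfolding set_integrable_def by (intro integrable_mult_indicator f(1)) (simp add: that)
    define u where "u z = indicator ?U z *\<^sub>R (f z - ?g z)" for z
    have Ucb: "?U \<subseteq> cbox a b" by (rule box_subset_cbox)
    have "AE z in lborel. u z = 0"
    proof (rule AE_zero_if_box_integrals_zero)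
      have "set_integrable lborel ?U (\<lambda>z. f z - ?g z)"
        by (intro set_integral_diff(1) f_int g_int Ucb) auto
      then show "integrable lborel u" by (simp add: u_def[abs_def] set_integrable_def)
      fix c d
      obtain c' d' where cd: "?U \<inter> box c d = box c' d'" using box_Int_box by blast
      have sub: "box c' d' \<subseteq> cbox a b" using cd Ucb by blast
      have "set_lebesgue_integral lborel (box c d) u = set_lebesgue_integral lborel (box c' d') (\<lambda>z. f z - ?g z)"
        unfolding set_lebesgue_integral_def u_def cd[symmetric]
        by (intro Bochner_Integration.integral_cong refl) (auto simp: indicator_def)
      also have "\<dots> = set_lebesgue_integral lborel (box c' d') f - set_lebesgue_integral lborel (box c' d') ?g"
        by (intro set_integral_diff(2) f_int g_int sub) auto
      also have "set_lebesgue_integral lborel (box c' d') f = set_lebesgue_integral lborel (box c' d') ?g"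
        by (rule integral_box_eq_if_mollification_eq[OF f(1) N])
          (use m sub ab(2) in \<open>auto simp: m_def[symmetric] subset_iff\<close>)
      finally show "set_lebesgue_integral lborel (box c d) u = 0" by simp
    qed
    then have "AE z in lborel. z \<in> ?U \<longrightarrow> f z = ?g z"
      by eventually_elim (auto simp: u_def)
    then show ?thesis using ab(1) open_box by blast
  qed
  then obtain U where U: "\<And>p. p \<in> \<Omega> \<Longrightarrow> open (U p) \<and> p \<in> U p \<and>
      (AE z in lborel. z \<in> U p \<longrightarrow> f z = G (complex_of_vec z))"
    by metis
  obtain \<F> where F: "\<F> \<subseteq> U ` \<Omega>" "countable \<F>" "\<Union>\<F> = \<Union>(U ` \<Omega>)"
    using Lindelof[of "U ` \<Omega>"] U by auto
  have "AE z in lborel. \<forall>V\<in>\<F>. z \<in> V \<longrightarrow> f z = G (complex_of_vec z)"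
    using F U by (subst AE_ball_countable) auto
  then have "AE z in lborel. z \<in> \<Omega> \<longrightarrow> f z = G (complex_of_vec z)"
    by eventually_elim (use F(3) U in blast)
  with hol show ?thesis by (rule that)
qed

end

section \<open>Conjugate harmonic potentials\<close>

lemma has_derivative_linear_holomorphic:
  assumes L: "bounded_linear L" and G: "G holomorphic_on complex_of_vec ` \<Omega>"
    and \<Omega>: "open (complex_of_vec ` \<Omega>)" and x: "x \<in> \<Omega>"
  shows "((\<lambda>x. L (G (complex_of_vec x))) has_derivative
    (\<lambda>v. L (deriv G (complex_of_vec x) * complex_of_vec v))) (at x)"
proof -
  have "(G has_derivative (*) (deriv G (complex_of_vec x))) (at (complex_of_vec x))"
    using holomorphic_derivI[OF G \<Omega>] x by (simp add: has_field_derivative_def)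
  then show ?thesis
    by (intro bounded_linear.has_derivative[OF L]
        has_derivative_compose[OF bounded_linear_imp_has_derivative[OF bounded_linear_complex_of_vec]])
qed

lemma complex_of_vec_axis: "complex_of_vec (axis 1 1) = 1" "complex_of_vec (axis 2 1) = \<i>"
  by (simp_all add: complex_eq_iff axis_def)

lemma partial_deriv_linear_holomorphic:
  assumes "bounded_linear L" "G holomorphic_on complex_of_vec ` \<Omega>" "open (complex_of_vec ` \<Omega>)" "x \<in> \<Omega>"
  shows "partial_deriv 1 (\<lambda>x. L (G (complex_of_vec x))) x = L (deriv G (complex_of_vec x))"
    and "partial_deriv 2 (\<lambda>x. L (G (complex_of_vec x))) x = L (deriv G (complex_of_vec x) * \<i>)"
  using partial_deriv_eq[OF has_derivative_linear_holomorphic[OF assms]] by (simp_all add: complex_of_vec_axis)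

lemma bounded_linear_vec_of_complex: "bounded_linear vec_of_complex"
  unfolding linear_conv_bounded_linear[symmetric]
  by (rule linearI) (simp_all add: vec_of_complex_def vec_eq_iff forall_2)

lemma open_complex_of_vec_image: "open \<Omega> \<Longrightarrow> open (complex_of_vec ` \<Omega>)"
proof -
  assume "open \<Omega>"
  moreover have "complex_of_vec ` \<Omega> = vec_of_complex -` \<Omega>"
    by (auto simp: image_iff) (metis complex_of_vec_inverse)
  moreover have "continuous_on UNIV vec_of_complex"
    by (intro linear_continuous_on bounded_linear_vec_of_complex)
  ultimately show ?thesis by (simp add: open_vimage)
qed

text \<open>Quantifying over \<open>L\<close> and \<open>G\<close> makes the class of functions closed under both partial
derivatives: they replace \<open>G\<close> by its derivative and, for the second variable, \<open>L\<close> by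
\<open>z \<mapsto> L (\<i> z)\<close>. It covers real and imaginary parts as well as vector fields.\<close>
lemma C_k_on_linear_holomorphic:
  assumes "bounded_linear L" "G holomorphic_on complex_of_vec ` \<Omega>" "open \<Omega>"
  shows "C_k_on k (\<lambda>x. L (G (complex_of_vec x))) \<Omega>"
  using assms(1,2)
proof (induction k arbitrary: L G)
  case 0
  show ?case
    using has_derivative_linear_holomorphic[OF 0 open_complex_of_vec_image[OF assms(3)]]
    by (auto intro!: continuous_at_imp_continuous_on intro: has_derivative_continuous)
next
  case (Suc k)
  note o = open_complex_of_vec_image[OF assms(3)]
  have G': "deriv G holomorphic_on complex_of_vec ` \<Omega>" by (rule holomorphic_deriv[OF Suc.prems(2) o])
  have "C_k_on k (partial_deriv i (\<lambda>x. L (G (complex_of_vec x)))) \<Omega>" for i :: 2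
  proof -
    have L': "bounded_linear (\<lambda>z. L (z * \<i>))"
      by (rule bounded_linear_compose[OF Suc.prems(1) bounded_linear_mult_left])
    consider "i = 1" | "i = 2" using exhaust_2 by blast
    then show ?thesis
    proof cases
      case 1
      show ?thesis
        unfolding 1 by (rule C_k_on_transform[OF assms(3) Suc.IH[OF Suc.prems(1) G']
              partial_deriv_linear_holomorphic(1)[OF Suc.prems o]])
    next
      case 2
      show ?thesis
        unfolding 2 by (rule C_k_on_transform[OF assms(3) Suc.IH[OF L' G']
              partial_deriv_linear_holomorphic(2)[OF Suc.prems o]])
    qed
  qed
  moreover have "(\<lambda>x. L (G (complex_of_vec x))) differentiable (at x)" if "x \<in> \<Omega>" for x
    using has_derivative_linear_holomorphic[OF Suc.prems o that] by (auto simp: differentiable_def)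
  ultimately show ?case by simp
qed

lemma holomorphic_conjugate_harmonic:
  assumes G: "G holomorphic_on complex_of_vec ` \<Omega>" and \<Omega>: "open \<Omega>"
  shows "conjugate_harmonic_on (\<lambda>x. Re (G (complex_of_vec x))) (\<lambda>x. Im (G (complex_of_vec x))) \<Omega>"
proof -
  note o = open_complex_of_vec_image[OF \<Omega>]
  have G': "deriv G holomorphic_on complex_of_vec ` \<Omega>" by (rule holomorphic_deriv[OF G o])
  have harm: "harmonic_on (\<lambda>x. L (G (complex_of_vec x))) \<Omega>" if L: "bounded_linear L" for L :: "complex \<Rightarrow> real"
    unfolding harmonic_on_def
  proof (intro conjI ballI)
    show "C_k_on 2 (\<lambda>x. L (G (complex_of_vec x))) \<Omega>"
      by (rule C_k_on_linear_holomorphic[OF L G \<Omega>])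
    fix x assume x: "x \<in> \<Omega>"
    have L': "bounded_linear (\<lambda>z. L (z * \<i>))"
      by (rule bounded_linear_compose[OF L bounded_linear_mult_left])
    have "partial_deriv 1 (partial_deriv 1 (\<lambda>x. L (G (complex_of_vec x)))) x =
        partial_deriv 1 (\<lambda>x. L (deriv G (complex_of_vec x))) x"
      by (rule partial_deriv_cong[OF \<Omega> x partial_deriv_linear_holomorphic(1)[OF L G o]])
    moreover have "partial_deriv 2 (partial_deriv 2 (\<lambda>x. L (G (complex_of_vec x)))) x =
        partial_deriv 2 (\<lambda>x. L (deriv G (complex_of_vec x) * \<i>)) x"
      by (rule partial_deriv_cong[OF \<Omega> x partial_deriv_linear_holomorphic(2)[OF L G o]])
    moreover have "L (- z) = - L z" for z
      using L by (simp add: bounded_linear.linear linear_neg)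
    ultimately show "partial_deriv 1 (partial_deriv 1 (\<lambda>x. L (G (complex_of_vec x)))) x +
        partial_deriv 2 (partial_deriv 2 (\<lambda>x. L (G (complex_of_vec x)))) x = 0"
      using partial_deriv_linear_holomorphic[OF L G' o x] partial_deriv_linear_holomorphic[OF L' G' o x]
      by (simp add: mult.assoc)
  qed
  show ?thesis
    unfolding conjugate_harmonic_on_def
    using harm[OF bounded_linear_Re] harm[OF bounded_linear_Im]
      partial_deriv_linear_holomorphic[OF bounded_linear_Re G o] partial_deriv_linear_holomorphic[OF bounded_linear_Im G o]
    by simp
qed

lemma integrable_lebesgue_AE_eq_lborel:
  fixes f :: "'a::euclidean_space \<Rightarrow> real"
  assumes "integrable lebesgue f"
  obtains g where "integrable lborel g" "AE x in lborel. f x = g x"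
proof -
  obtain g where g: "g \<in> borel_measurable lborel" "AE x in lborel. f x = g x"
    using completion_ex_borel_measurable_real[OF borel_measurable_integrable[OF assms]] by blast
  have "integrable lebesgue g"
    by (rule integrable_cong_AE_imp[OF assms]) (use g AE_completion in \<open>auto intro: measurable_completion\<close>)
  then have "integrable lborel g" using g(1) by (simp add: integrable_completion)
  then show ?thesis using g(2) by (rule that)
qed

lemma L2_on_bounded_integrable:
  fixes f :: "real^2 \<Rightarrow> real"
  assumes "f \<in> L2_on \<Omega>" "open \<Omega>" "bounded \<Omega>"
  shows "integrable (lebesgue_on \<Omega>) f"
proof (rule Bochner_Integration.integrable_bound)
  have "emeasure lborel \<Omega> < \<infinity>" using assms(3) by (rule emeasure_bounded_finite)
  then have "finite_measure (lebesgue_on \<Omega>)"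
    using assms(2) by (intro finite_measureI) (auto simp: emeasure_restrict_space)
  then have "integrable (lebesgue_on \<Omega>) (\<lambda>x. 1 :: real)" by (simp add: finite_measure.integrable_const)
  then show "integrable (lebesgue_on \<Omega>) (\<lambda>x. 1 + (norm (f x))\<^sup>2)"
    using assms(1) by (intro Bochner_Integration.integrable_add) (auto simp: L2_on_def)
  show "f \<in> borel_measurable (lebesgue_on \<Omega>)" using assms(1) by (simp add: L2_on_def)
  have "norm y \<le> norm (1 + (norm y)\<^sup>2)" for y :: real
  proof -
    have "0 \<le> (norm y - 1 / 2)\<^sup>2" by simp
    then show ?thesis by (simp add: power2_eq_square algebra_simps)
  qed
  then show "AE x in lebesgue_on \<Omega>. norm (f x) \<le> norm (1 + (norm (f x))\<^sup>2)" by simp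
qed

text \<open>Extends \<open>u\<close> by 0 and passes to a Borel representative: exchanging integrals against mollifiers
requires measurability on the product of two Borel planes.\<close>
lemma L2_on_integrable_extension:
  fixes u :: "real^2 \<Rightarrow> real"
  assumes u: "u \<in> L2_on \<Omega>" and \<Omega>: "open \<Omega>" "bounded \<Omega>"
  obtains u' where "integrable lborel u'" "AE x in lborel. x \<in> \<Omega> \<longrightarrow> u x = u' x"
    "\<forall>\<eta>\<in>test_functions \<Omega>. (\<integral>x. u x * \<eta> x \<partial>lebesgue_on \<Omega>) = (\<integral>x. u' x * \<eta> x \<partial>lborel)"
proof -
  have \<Omega>s: "\<Omega> \<in> sets lebesgue" using \<Omega>(1) by simp
  have int: "integrable lebesgue (\<lambda>x. indicator \<Omega> x * u x)"
    using L2_on_bounded_integrable[OF u \<Omega>] \<Omega>s by (simp add: integrable_restrict_space)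
  then obtain u' where u': "integrable lborel u'" "AE x in lborel. indicator \<Omega> x * u x = u' x"
    by (rule integrable_lebesgue_AE_eq_lborel)
  show ?thesis
  proof (rule that[OF u'(1)])
    show "AE x in lborel. x \<in> \<Omega> \<longrightarrow> u x = u' x"
      using u'(2) by eventually_elim auto
  next
    show "\<forall>\<eta>\<in>test_functions \<Omega>. (\<integral>x. u x * \<eta> x \<partial>lebesgue_on \<Omega>) = (\<integral>x. u' x * \<eta> x \<partial>lborel)"
    proof
      fix \<eta> assume \<eta>: "\<eta> \<in> test_functions \<Omega>"
      have m\<eta>: "\<eta> \<in> borel_measurable lborel"
        using test_function_measurable[OF \<eta>] by simp
      have m: "(\<lambda>x. u' x * \<eta> x) \<in> borel_measurable lborel"
        by (intro borel_measurable_times borel_measurable_integrable[OF u'(1)] m\<eta>)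
      have "(\<integral>x. u x * \<eta> x \<partial>lebesgue_on \<Omega>) = (\<integral>x. indicator \<Omega> x * u x * \<eta> x \<partial>lebesgue)"
        using \<Omega>s by (simp add: integral_restrict_space mult.assoc)
      also have "\<dots> = (\<integral>x. u' x * \<eta> x \<partial>lebesgue)"
      proof (rule integral_cong_AE)
        show "(\<lambda>x. indicator \<Omega> x * u x * \<eta> x) \<in> borel_measurable lebesgue"
          by (rule borel_measurable_times[OF borel_measurable_integrable[OF int] measurable_completion[OF m\<eta>]])
        show "AE x in lebesgue. indicator \<Omega> x * u x * \<eta> x = u' x * \<eta> x"
          using AE_completion[OF u'(2)] by eventually_elim simp
      qed (rule measurable_completion[OF m])
      also have "\<dots> = (\<integral>x. u' x * \<eta> x \<partial>lborel)" by (rule integral_completion[OF m])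
      finally show "(\<integral>x. u x * \<eta> x \<partial>lebesgue_on \<Omega>) = (\<integral>x. u' x * \<eta> x \<partial>lborel)" .
    qed
  qed
qed

lemma weak_Cauchy_Riemann_imp_holomorphic:
  fixes \<phi> \<psi> :: "real^2 \<Rightarrow> real"
  assumes \<Omega>: "open \<Omega>" "bounded \<Omega>" and L2: "\<phi> \<in> L2_on \<Omega>" "\<psi> \<in> L2_on \<Omega>"
    and CR1: "\<And>\<eta>. \<eta> \<in> test_functions \<Omega> \<Longrightarrow>
      (\<integral>x. \<phi> x * partial_deriv 1 \<eta> x \<partial>lebesgue_on \<Omega>) = (\<integral>x. \<psi> x * partial_deriv 2 \<eta> x \<partial>lebesgue_on \<Omega>)"
    and CR2: "\<And>\<eta>. \<eta> \<in> test_functions \<Omega> \<Longrightarrow>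
      (\<integral>x. \<phi> x * partial_deriv 2 \<eta> x \<partial>lebesgue_on \<Omega>) = - (\<integral>x. \<psi> x * partial_deriv 1 \<eta> x \<partial>lebesgue_on \<Omega>)"
  obtains G where "G holomorphic_on complex_of_vec ` \<Omega>"
    "AE x in lebesgue_on \<Omega>. \<phi> x = Re (G (complex_of_vec x)) \<and> \<psi> x = Im (G (complex_of_vec x))"
proof -
  have \<Omega>s: "\<Omega> \<in> sets lebesgue" using \<Omega>(1) by simp
  obtain \<phi>' where p: "integrable lborel \<phi>'" "AE x in lborel. x \<in> \<Omega> \<longrightarrow> \<phi> x = \<phi>' x"
    "\<forall>\<eta>\<in>test_functions \<Omega>. (\<integral>x. \<phi> x * \<eta> x \<partial>lebesgue_on \<Omega>) = (\<integral>x. \<phi>' x * \<eta> x \<partial>lborel)"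
    by (rule L2_on_integrable_extension[OF L2(1) \<Omega>])
  obtain \<psi>' where q: "integrable lborel \<psi>'" "AE x in lborel. x \<in> \<Omega> \<longrightarrow> \<psi> x = \<psi>' x"
    "\<forall>\<eta>\<in>test_functions \<Omega>. (\<integral>x. \<psi> x * \<eta> x \<partial>lebesgue_on \<Omega>) = (\<integral>x. \<psi>' x * \<eta> x \<partial>lborel)"
    by (rule L2_on_integrable_extension[OF L2(2) \<Omega>])
  define f where "f x = Complex (\<phi>' x) (\<psi>' x)" for x
  have f_int: "integrable lborel f"
    unfolding f_def[abs_def] Complex_eq using p(1) q(1) by (intro Bochner_Integration.integrable_add integrable_mult_right integrable_of_real)
  have "weakly_holomorphic \<Omega> f"
    unfolding weakly_holomorphic_def
  proof
    fix \<eta> assume \<eta>: "\<eta> \<in> test_functions \<Omega>"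
    note t = test_function_partial_deriv[OF \<eta>]
    have int: "integrable lborel (\<lambda>x. u x * partial_deriv i \<eta> x)" if "integrable lborel u" for u :: "real^2 \<Rightarrow> real" and i
    proof -
      obtain B where "\<And>x. \<bar>partial_deriv i \<eta> x\<bar> \<le> B" using test_function_bounded[OF t] by blast
      then show ?thesis
        using test_function_measurable[OF t] by (intro integrable_mult_bounded[OF that]) auto
    qed
    let ?I = "\<integral>z. f z * Complex (partial_deriv 1 \<eta> z) (partial_deriv 2 \<eta> z) \<partial>lborel"
    note fi = integrable_mult_gradient[OF f_int \<eta>]
    have "Re ?I = (\<integral>x. \<phi>' x * partial_deriv 1 \<eta> x \<partial>lborel) - (\<integral>x. \<psi>' x * partial_deriv 2 \<eta> x \<partial>lborel)"
      using int[OF p(1)] int[OF q(1)] fi by (subst integral_Re[symmetric]) (auto simp: f_def)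
    also have "\<dots> = 0"
      using CR1[OF \<eta>] by (simp add: p(3)[rule_format, OF t] q(3)[rule_format, OF t])
    finally have "Re ?I = 0" .
    have "Im ?I = (\<integral>x. \<phi>' x * partial_deriv 2 \<eta> x \<partial>lborel) + (\<integral>x. \<psi>' x * partial_deriv 1 \<eta> x \<partial>lborel)"
      using int[OF p(1)] int[OF q(1)] fi by (subst integral_Im[symmetric]) (auto simp: f_def)
    also have "\<dots> = 0"
      using CR2[OF \<eta>] by (simp add: p(3)[rule_format, OF t] q(3)[rule_format, OF t])
    finally show "?I = 0" using \<open>Re ?I = 0\<close> by (simp add: complex_eq_iff)
  qed
  note weak = this
  obtain H h where "smooth_cutoff H h" using ex_smooth_cutoff by blast
  then interpret smooth_cutoff H h .
  obtain G where G: "G holomorphic_on complex_of_vec ` \<Omega>"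
    "AE z in lborel. z \<in> \<Omega> \<longrightarrow> f z = G (complex_of_vec z)"
    by (rule weakly_holomorphic_imp_AE_eq_holomorphic[OF f_int weak \<Omega>(1)])
  have "AE x in lborel. x \<in> \<Omega> \<longrightarrow> \<phi> x = Re (G (complex_of_vec x)) \<and> \<psi> x = Im (G (complex_of_vec x))"
    using G(2) p(2) q(2) by eventually_elim (auto simp: f_def complex_eq_iff)
  then have "AE x in lebesgue_on \<Omega>. \<phi> x = Re (G (complex_of_vec x)) \<and> \<psi> x = Im (G (complex_of_vec x))"
    using \<Omega>s by (subst AE_restrict_space_iff) (auto intro: AE_completion)
  with G(1) show ?thesis by (rule that)
qed

theorem theorem3p6:
  fixes \<Omega> :: "(real^2) set" and v :: "real^2 \<Rightarrow> real^2"
  assumes "region \<Omega>" and "bounded \<Omega>"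
    and "\<exists>\<C>. finite \<C> \<and> (\<forall>C\<in>\<C>. simple_lipschitz_loop C) \<and> pairwise disjnt \<C> \<and>
             frontier \<Omega> = \<Union>\<C>"
    and "v \<in> gradient_fields \<Omega> \<inter> curl_fields \<Omega>"
  shows "(\<forall>\<phi> \<psi>. potentials \<Omega> v \<phi> \<psi> \<longrightarrow>
           (\<exists>\<phi>' \<psi>'. (AE x in lebesgue_on \<Omega>. \<phi> x = \<phi>' x) \<and> (AE x in lebesgue_on \<Omega>. \<psi> x = \<psi>' x) \<and>
                    conjugate_harmonic_on \<phi>' \<psi>' \<Omega>)) \<and>
         (\<exists>v'. (AE x in lebesgue_on \<Omega>. v x = v' x) \<and> C_infinity_on v' \<Omega>)"
proof (intro conjI allI impI)
  have \<Omega>: "open \<Omega>" "bounded \<Omega>" using assms(1,2) by (auto simp: region_def)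
  fix \<phi> \<psi> assume pot: "potentials \<Omega> v \<phi> \<psi>"
  then obtain w where \<phi>: "has_weak_gradient \<Omega> \<phi> v" and \<psi>: "has_weak_gradient \<Omega> \<psi> w" and v: "v = rotate_field w"
    by (auto simp: potentials_def has_weak_perp_gradient_def)
  have v12: "v x $ 1 = w x $ 2" "v x $ 2 = - w x $ 1" for x
    by (simp_all add: v rotate_field_def)
  obtain G where G: "G holomorphic_on complex_of_vec ` \<Omega>"
    "AE x in lebesgue_on \<Omega>. \<phi> x = Re (G (complex_of_vec x)) \<and> \<psi> x = Im (G (complex_of_vec x))"
  proof (rule weak_Cauchy_Riemann_imp_holomorphic[OF \<Omega>])
    show "\<phi> \<in> L2_on \<Omega>" "\<psi> \<in> L2_on \<Omega>" using \<phi> \<psi> by (auto simp: has_weak_gradient_def)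
    fix \<eta> assume \<eta>: "\<eta> \<in> test_functions \<Omega>"
    have e: "(\<integral>x. \<phi> x * partial_deriv i \<eta> x \<partial>lebesgue_on \<Omega>) = - (\<integral>x. v x $ i * \<eta> x \<partial>lebesgue_on \<Omega>)"
      "(\<integral>x. \<psi> x * partial_deriv i \<eta> x \<partial>lebesgue_on \<Omega>) = - (\<integral>x. w x $ i * \<eta> x \<partial>lebesgue_on \<Omega>)" for i
      using \<phi> \<psi> \<eta> by (simp_all add: has_weak_gradient_def)
    show "(\<integral>x. \<phi> x * partial_deriv 1 \<eta> x \<partial>lebesgue_on \<Omega>) = (\<integral>x. \<psi> x * partial_deriv 2 \<eta> x \<partial>lebesgue_on \<Omega>)"
      unfolding e v12 ..
    show "(\<integral>x. \<phi> x * partial_deriv 2 \<eta> x \<partial>lebesgue_on \<Omega>) = - (\<integral>x. \<psi> x * partial_deriv 1 \<eta> x \<partial>lebesgue_on \<Omega>)"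
      unfolding e v12 by simp
  qed
  show "\<exists>\<phi>' \<psi>'. (AE x in lebesgue_on \<Omega>. \<phi> x = \<phi>' x) \<and> (AE x in lebesgue_on \<Omega>. \<psi> x = \<psi>' x) \<and>
      conjugate_harmonic_on \<phi>' \<psi>' \<Omega>"
    using G(2) holomorphic_conjugate_harmonic[OF G(1) \<Omega>(1)]
    by (intro exI[of _ "\<lambda>x. Re (G (complex_of_vec x))"] exI[of _ "\<lambda>x. Im (G (complex_of_vec x))"]) auto
next
  have \<Omega>: "open \<Omega>" "bounded \<Omega>" using assms(1,2) by (auto simp: region_def)
  obtain \<phi> where \<phi>: "has_weak_gradient \<Omega> \<phi> v" using assms(4) by (auto simp: gradient_fields_def)
  obtain \<psi> w where \<psi>: "has_weak_gradient \<Omega> \<psi> w" and v: "v = rotate_field w"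
    using assms(4) by (auto simp: curl_fields_def has_weak_perp_gradient_def)
  have v12: "v x $ 1 = w x $ 2" "v x $ 2 = - w x $ 1" for x
    by (simp_all add: v rotate_field_def)
  have comp: "(\<lambda>x. v x $ i) \<in> L2_on \<Omega>" for i
  proof -
    have vL: "v \<in> borel_measurable (lebesgue_on \<Omega>)" "integrable (lebesgue_on \<Omega>) (\<lambda>x. (norm (v x))\<^sup>2)"
      using \<phi> by (auto simp: has_weak_gradient_def L2_on_def)
    have m: "(\<lambda>x. v x $ i) \<in> borel_measurable (lebesgue_on \<Omega>)"
      using vL(1) by (intro measurable_compose[OF vL(1)] borel_measurable_continuous_onI continuous_intros)
    moreover have "integrable (lebesgue_on \<Omega>) (\<lambda>x. (norm (v x $ i))\<^sup>2)"
    proof (rule Bochner_Integration.integrable_bound[OF vL(2)])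
      show "(\<lambda>x. (norm (v x $ i))\<^sup>2) \<in> borel_measurable (lebesgue_on \<Omega>)"
        using m by measurable
      have "norm ((norm (v x $ i))\<^sup>2) \<le> norm ((norm (v x))\<^sup>2)" for x
        using power_mono[OF component_le_norm_cart[of "v x" i], of 2] by simp
      then show "AE x in lebesgue_on \<Omega>. norm ((norm (v x $ i))\<^sup>2) \<le> norm ((norm (v x))\<^sup>2)"
        by simp
    qed
    ultimately show ?thesis by (simp add: L2_on_def)
  qed
  \<comment> \<open>both weak Cauchy--Riemann equations for \<open>v\<^sub>1 - \<i> v\<^sub>2\<close> reduce to the symmetry of second derivatives\<close>
  obtain G where G: "G holomorphic_on complex_of_vec ` \<Omega>"
    "AE x in lebesgue_on \<Omega>. v x $ 1 = Re (G (complex_of_vec x)) \<and> - v x $ 2 = Im (G (complex_of_vec x))"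
  proof (rule weak_Cauchy_Riemann_imp_holomorphic[OF \<Omega>])
    show "(\<lambda>x. v x $ 1) \<in> L2_on \<Omega>" by (rule comp)
    show "(\<lambda>x. - v x $ 2) \<in> L2_on \<Omega>" using comp[of 2] by (simp add: L2_on_def)
    fix \<eta> assume \<eta>: "\<eta> \<in> test_functions \<Omega>"
    note t = test_function_partial_deriv[OF \<eta>]
    have "C_k_on 2 \<eta> UNIV" using \<eta> by (simp add: test_functions_def C_infinity_on_def)
    then have sym: "partial_deriv 1 (partial_deriv 2 \<eta>) = partial_deriv 2 (partial_deriv 1 \<eta>)"
      by (intro ext mixed_partials_commute)
    have e: "(\<integral>x. v x $ i * partial_deriv j \<eta> x \<partial>lebesgue_on \<Omega>) = - (\<integral>x. \<phi> x * partial_deriv i (partial_deriv j \<eta>) x \<partial>lebesgue_on \<Omega>)"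
      "(\<integral>x. w x $ i * partial_deriv j \<eta> x \<partial>lebesgue_on \<Omega>) = - (\<integral>x. \<psi> x * partial_deriv i (partial_deriv j \<eta>) x \<partial>lebesgue_on \<Omega>)" for i j
      using \<phi> \<psi> t by (simp_all add: has_weak_gradient_def)
    show "(\<integral>x. v x $ 1 * partial_deriv 1 \<eta> x \<partial>lebesgue_on \<Omega>) = (\<integral>x. - v x $ 2 * partial_deriv 2 \<eta> x \<partial>lebesgue_on \<Omega>)"
      using e(2)[of 2 1] e(2)[of 1 2] by (simp add: v12 sym)
    show "(\<integral>x. v x $ 1 * partial_deriv 2 \<eta> x \<partial>lebesgue_on \<Omega>) = - (\<integral>x. - v x $ 2 * partial_deriv 1 \<eta> x \<partial>lebesgue_on \<Omega>)"
      using e(1)[of 1 2] e(1)[of 2 1] by (simp add: sym)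
  qed
  have "bounded_linear (\<lambda>z. vec_of_complex (cnj z))"
    by (rule bounded_linear_compose[OF bounded_linear_vec_of_complex bounded_linear_cnj])
  then have "C_infinity_on (\<lambda>x. vec_of_complex (cnj (G (complex_of_vec x)))) \<Omega>"
    unfolding C_infinity_on_def using C_k_on_linear_holomorphic[OF _ G(1) \<Omega>(1)] by blast
  moreover have "AE x in lebesgue_on \<Omega>. v x = vec_of_complex (cnj (G (complex_of_vec x)))"
    using G(2) by eventually_elim (auto simp: vec_of_complex_def vec_eq_iff forall_2)
  ultimately show "\<exists>v'. (AE x in lebesgue_on \<Omega>. v x = v' x) \<and> C_infinity_on v' \<Omega>"
    by (intro exI[of _ "\<lambda>x. vec_of_complex (cnj (G (complex_of_vec x)))"] conjI)
qed

end
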